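(* Let $\Omega=[0,1)$ with Lebesgue measure $\mathbb P$ and let $p(\cdot):[0,1)\to(0,\infty)$ be measurable with $1<p_-\le p_+<\infty$, where $p_-=\operatorname{ess\,inf}p$, $p_+=\operatorname{ess\,sup}p$. Assume that there is a constant $K\ge1$ such that $\mathbb P(A)^{p_-(A)-p_+(A)}\le K$ for every dyadic interval $A\subset[0,1)$. If $f\in L_{p(\cdot)}$, then $$\lim_{n\to\infty}s_nf=f\qquad\text{in the } L_{p(\cdot)}\text{-norm}.$$
   Context: For measurable $A\subset[0,1)$, $p_-(A)=\operatorname{ess\,inf}_{x\in A}p(x)$ and $p_+(A)=\operatorname{ess\,sup}_{x\in A}p(x)$. $\|f\|_{p(\cdot)}=\inf\{\lambda>0:\int_0^1(|f(x)|/\lambda)^{p(x)}dx\le1\}$, and $L_{p(\cdot)}$ is the space of measurable functions on $[0,1)$ with finite norm. Dyadic intervals are $[k2^{-n},(k+1)2^{-n})$, $n\in\mathbb N=\{0,1,2,\dots\}$, $0\le k<2^n$. Walsh system: $r(x)=1$ on $[0,1/2)$, $r(x)=-1$ on $[1/2,1)$, extended with period 1; $r_n(x)=r(2^nx)$; for $n=\sum_{k\ge0}n_k2^k$ with $n_k\in\{0,1\}$, $w_n=\prod_{k\ge0}r_k^{n_k}$. For $f\in L_1$, $\widehat f(n)=\int_0^1fw_n$ and $s_nf=\sum_{k=0}^{n-1}\widehat f(k)w_k$. *)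

theory Defs
  imports "HOL-Probability.Essential_Supremum"
begin

abbreviation unit_leb :: "real measure" where
  "unit_leb \<equiv> lebesgue_on {0..<1}"

(* Counterpart of the library's esssup (without its separate value for
   non-measurable functions). *)
definition essinf :: "'a measure \<Rightarrow> ('a \<Rightarrow> 'b::complete_lattice) \<Rightarrow> 'b" where
  "essinf M f = Liminf (ae_filter M) f"

definition p_minus :: "(real \<Rightarrow> real) \<Rightarrow> real set \<Rightarrow> ereal" where
  "p_minus p A = essinf (lebesgue_on A) (\<lambda>x. ereal (p x))"

definition p_plus :: "(real \<Rightarrow> real) \<Rightarrow> real set \<Rightarrow> ereal" where
  "p_plus p A = esssup (lebesgue_on A) (\<lambda>x. ereal (p x))"

(* The infimum is taken in ennreal, so that it is \<infinity> when no c is admissible. *)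
definition luxemburg_norm :: "(real \<Rightarrow> real) \<Rightarrow> (real \<Rightarrow> real) \<Rightarrow> ennreal" where
  "luxemburg_norm p f =
     (INF c\<in>{c::real. 0 < c \<and> (\<integral>\<^sup>+x. ennreal ((\<bar>f x\<bar> / c) powr p x) \<partial>unit_leb) \<le> 1}. ennreal c)"

definition var_Lp :: "(real \<Rightarrow> real) \<Rightarrow> (real \<Rightarrow> real) set" where
  "var_Lp p = {f \<in> borel_measurable unit_leb. luxemburg_norm p f < \<infinity>}"

definition dyadic_intervals :: "real set set" where
  "dyadic_intervals = {{real k / 2 ^ n ..< (real k + 1) / 2 ^ n} | (k::nat) (n::nat). k < 2 ^ n}"

definition rademacher_base :: "real \<Rightarrow> real" where
  "rademacher_base x = (if frac x < 1 / 2 then 1 else - 1)"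

definition rademacher :: "nat \<Rightarrow> real \<Rightarrow> real" where
  "rademacher n x = rademacher_base (2 ^ n * x)"

(* Only the (finitely many) k with binary digit n_k = 1 contribute a factor. *)
definition walsh :: "nat \<Rightarrow> real \<Rightarrow> real" where
  "walsh n x = (\<Prod>k | bit n k. rademacher k x)"

definition walsh_coeff :: "(real \<Rightarrow> real) \<Rightarrow> nat \<Rightarrow> real" where
  "walsh_coeff f n = (\<integral>x. f x * walsh n x \<partial>unit_leb)"

definition walsh_partial_sum :: "nat \<Rightarrow> (real \<Rightarrow> real) \<Rightarrow> real \<Rightarrow> real" where
  "walsh_partial_sum n f x = (\<Sum>k<n. walsh_coeff f k * walsh k x)"

end

theory Submission
  imports Defs
begin

text \<open>Dyadic step functions are dense in \<open>L\<^sub>p\<^sub>(\<^sub>\<cdot>\<^sub>)\<close>, because \<open>p\<close> is bounded, and \<open>s\<^sub>n \<phi> = \<phi>\<close> for every dyadic step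
function \<open>\<phi>\<close> and all large \<open>n\<close>. So the theorem follows once the operators \<open>s\<^sub>n\<close> are shown to be bounded
uniformly in \<open>n\<close> (\<open>walsh_partial_sum_bounded\<close>).

Up to multiplication by \<open>w\<^sub>n\<close>, which does not change absolute values, \<open>s\<^sub>n\<close> is a martingale transform with
coefficients \<open>0\<close> and \<open>1\<close>, the binary digits of \<open>n\<close>. In bilinear form (\<open>walsh_pairing\<close>), the integral of
\<open>s\<^sub>n f \<cdot> g\<close> is the sum over the digits \<open>n\<^sub>k = 1\<close> of the integrals of \<open>\<Delta>\<^sub>k(f w\<^sub>n) \<Delta>\<^sub>k(g w\<^sub>n)\<close>, where \<open>\<Delta>\<^sub>k\<close> denotes
the \<open>k\<close>-th dyadic martingale difference. A direct telescoping argument (\<open>weighted_square_function\<close>,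
\<open>dyadic_bilinear_bound\<close>) bounds this by three times the integral of \<open>M f \<cdot> M g\<close>, with \<open>M\<close> the dyadic maximal
operator.

It remains to bound \<open>M\<close> for the exponent \<open>p\<close> and for the conjugate exponent \<open>p' = p / (p - 1)\<close>. This is
where the hypothesis on \<open>p\<close> is used: it gives a Jensen-type inequality for averages with variable exponent
(\<open>dyadic_avg_powr_le_cell\<close>), which reduces the claim to Doob's maximal inequality with a constant
exponent. The hypothesis passes to \<open>p'\<close> with another constant (\<open>dyadic_log_Hoelder_conjugate\<close>).

The estimates are stated for modulars, that is, for the integrals of \<open>\<bar>f\<bar> powr p\<close>, and the Luxemburg norm appears
only in the theorem itself.\<close>

section \<open>Dyadic cells and averages\<close>

text \<open>The dyadic cell of generation \<open>n\<close> with number \<open>k\<close>, that is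
\<open>[k 2\<^sup>-\<^sup>n, (k+1) 2\<^sup>-\<^sup>n)\<close>. The cell that contains \<open>x\<close> has number \<open>\<lfloor>2 ^ n * x\<rfloor>\<close>, and \<open>k\<close> is an
integer so that this floor can be used directly. For numbers \<open>k\<close> outside \<open>{0..<2 ^ n}\<close> the cell is
empty.\<close>

definition dyadic_cell :: "nat \<Rightarrow> int \<Rightarrow> real set" where
  "dyadic_cell n k = {y \<in> {0..<1}. \<lfloor>2 ^ n * y\<rfloor> = k}"

text \<open>Functions on \<open>[0,1)\<close> that are constant on every dyadic cell of generation \<open>n\<close>, that is,
measurable with respect to the \<open>n\<close>-th dyadic \<open>\<sigma>\<close>-algebra. Nothing is required outside \<open>[0,1)\<close>.\<close>

definition dyadic_step :: "nat \<Rightarrow> (real \<Rightarrow> real) \<Rightarrow> bool" where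
  "dyadic_step n X \<longleftrightarrow>
     (\<forall>x\<in>{0..<1}. \<forall>y\<in>{0..<1}. \<lfloor>2 ^ n * x\<rfloor> = \<lfloor>2 ^ n * y\<rfloor> \<longrightarrow> X x = X y)"

text \<open>The conditional expectation of \<open>f\<close> on the \<open>n\<close>-th dyadic \<open>\<sigma>\<close>-algebra, as an explicit function:
its value at \<open>x\<close> is the average of \<open>f\<close> over the cell of generation \<open>n\<close> that contains \<open>x\<close>.\<close>

definition dyadic_avg :: "nat \<Rightarrow> (real \<Rightarrow> real) \<Rightarrow> real \<Rightarrow> real" where
  "dyadic_avg n f x = 2 ^ n * (\<integral>y. f y * indicator (dyadic_cell n \<lfloor>2 ^ n * x\<rfloor>) y \<partial>unit_leb)"

lemma space_unit_leb [simp]: "space unit_leb = {0..<1}"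
  by simp

lemma finite_measure_unit_leb: "finite_measure unit_leb"
  by (intro finite_measureI) (simp add: emeasure_restrict_space)

lemma measure_unit_leb [simp]: "measure unit_leb {0..<1} = 1"
  by (simp add: measure_restrict_space)

lemma measurable_unit_leb_of_borel: "g \<in> borel \<rightarrow>\<^sub>M M \<Longrightarrow> g \<in> unit_leb \<rightarrow>\<^sub>M M"
  by (intro measurable_restrict_space1 measurable_completion) simp

lemma floor_measurable [measurable]:
  "(\<lambda>x. \<lfloor>2 ^ n * x :: real\<rfloor>) \<in> unit_leb \<rightarrow>\<^sub>M count_space UNIV"
  by (rule measurable_unit_leb_of_borel) measurable

lemma floor_range: "0 \<le> x \<Longrightarrow> x < 1 \<Longrightarrow> \<lfloor>2 ^ n * x :: real\<rfloor> \<in> {0..<2 ^ n}"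
  by (auto simp: floor_less_iff)

lemma dyadic_cell_eq:
  assumes "0 \<le> k" "k < 2 ^ n"
  shows "dyadic_cell n k = {real_of_int k / 2 ^ n ..< (real_of_int k + 1) / 2 ^ n}"
proof -
  have "real_of_int (k + 1) \<le> real_of_int (2 ^ n)"
    using assms by (subst of_int_le_iff) simp
  then have *: "(real_of_int k + 1) / 2 ^ n \<le> 1" "0 \<le> real_of_int k / 2 ^ n"
    using assms by auto
  have eq: "(\<lfloor>2 ^ n * y\<rfloor> = k) = (real_of_int k / 2 ^ n \<le> y \<and> y < (real_of_int k + 1) / 2 ^ n)" for y
    unfolding floor_eq_iff by (auto simp: field_simps)
  have "dyadic_cell n k = {0..<1} \<inter> {real_of_int k / 2 ^ n ..< (real_of_int k + 1) / 2 ^ n}"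
    by (rule set_eqI) (simp only: dyadic_cell_def mem_Collect_eq eq Int_iff atLeastLessThan_iff)
  also have "\<dots> = {real_of_int k / 2 ^ n ..< (real_of_int k + 1) / 2 ^ n}"
    using * by (intro Int_absorb1) (simp add: ivl_subset)
  finally show ?thesis .
qed

lemma dyadic_cell_measurable [measurable]: "dyadic_cell n k \<in> sets unit_leb"
proof -
  have "dyadic_cell n k = (\<lambda>x. \<lfloor>2 ^ n * x\<rfloor>) -` {k} \<inter> space unit_leb"
    by (auto simp: dyadic_cell_def)
  then show ?thesis
    using measurable_sets[OF floor_measurable, of "{k}" n] by simp
qed

lemma dyadic_cell_measure:
  assumes "k \<in> {0..<2 ^ n}"
  shows "measure unit_leb (dyadic_cell n k) = 1 / 2 ^ n"
proof -
  have "measure unit_leb (dyadic_cell n k) = measure lebesgue (dyadic_cell n k)"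
    by (rule measure_restrict_space) (auto simp: dyadic_cell_def)
  also have "\<dots> = 1 / 2 ^ n"
    using assms by (subst dyadic_cell_eq) (auto simp: field_simps)
  finally show ?thesis .
qed

lemma dyadic_cell_Int: "dyadic_cell n k \<inter> {0..<1} = dyadic_cell n k"
  by (auto simp: dyadic_cell_def)

lemma dyadic_cell_left_endpoint:
  assumes "k \<in> {0..<2 ^ n}"
  shows "real_of_int k / 2 ^ n \<in> {0..<1}" "\<lfloor>2 ^ n * (real_of_int k / 2 ^ n)\<rfloor> = k"
proof -
  have "real_of_int k < real_of_int (2 ^ n)"
    using assms by (subst of_int_less_iff) simp
  then show "real_of_int k / 2 ^ n \<in> {0..<1}" using assms by simp
qed simp

lemma floor_Suc:
  "\<lfloor>2 ^ Suc n * x :: real\<rfloor> = 2 * \<lfloor>2 ^ n * x\<rfloor> + (if frac (2 ^ n * x) < 1 / 2 then 0 else 1)"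
  unfolding frac_def by (auto simp: floor_eq_iff; linarith)

lemma floor_Suc_div: "\<lfloor>2 ^ Suc n * x :: real\<rfloor> div 2 = \<lfloor>2 ^ n * x\<rfloor>"
  unfolding floor_Suc by auto

lemma dyadic_step_Suc: "dyadic_step n X \<Longrightarrow> dyadic_step (Suc n) X"
  unfolding dyadic_step_def by (metis floor_Suc_div)

lemma dyadic_step_mono: "n \<le> m \<Longrightarrow> dyadic_step n X \<Longrightarrow> dyadic_step m X"
  by (induction rule: dec_induct) (auto intro: dyadic_step_Suc)

lemma dyadic_step_map: "dyadic_step n X \<Longrightarrow> dyadic_step n (\<lambda>x. h (X x))"
  unfolding dyadic_step_def by metis

lemma dyadic_step_map2: "dyadic_step n X \<Longrightarrow> dyadic_step n Y \<Longrightarrow> dyadic_step n (\<lambda>x. h (X x) (Y x))"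
  unfolding dyadic_step_def by metis

lemma dyadic_step_arith:
  assumes "dyadic_step n X" "dyadic_step n Y"
  shows "dyadic_step n (\<lambda>x. X x + Y x)" "dyadic_step n (\<lambda>x. X x - Y x)"
    "dyadic_step n (\<lambda>x. X x * Y x)" "dyadic_step n (\<lambda>x. X x / Y x)"
    "dyadic_step n (\<lambda>x. max (X x) (Y x))"
  by (rule dyadic_step_map2[OF assms])+

lemma dyadic_step_const: "dyadic_step n (\<lambda>x. c)"
  unfolding dyadic_step_def by auto

lemma dyadic_step_sum: "(\<And>i. i \<in> I \<Longrightarrow> dyadic_step n (X i)) \<Longrightarrow> dyadic_step n (\<lambda>x. \<Sum>i\<in>I. X i x)"
  unfolding dyadic_step_def by (intro ballI impI sum.cong refl) blast

lemma dyadic_step_prod: "(\<And>i. i \<in> I \<Longrightarrow> dyadic_step n (X i)) \<Longrightarrow> dyadic_step n (\<lambda>x. \<Prod>i\<in>I. X i x)"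
  unfolding dyadic_step_def by (intro ballI impI prod.cong refl) blast

lemma dyadic_step_avg: "dyadic_step n (dyadic_avg n f)"
  unfolding dyadic_step_def dyadic_avg_def by simp

lemma dyadic_step_eq:
  assumes "dyadic_step n X" "x \<in> {0..<1}"
  shows "X x = X (real_of_int \<lfloor>2 ^ n * x\<rfloor> / 2 ^ n)"
proof -
  have "\<lfloor>2 ^ n * x\<rfloor> \<in> {0..<2 ^ n}" using assms floor_range by simp
  from dyadic_cell_left_endpoint[OF this] show ?thesis
    using assms unfolding dyadic_step_def by metis
qed

lemma dyadic_step_measurable:
  assumes "dyadic_step n X"
  shows "X \<in> borel_measurable unit_leb"
proof -
  have "(\<lambda>x. X (real_of_int \<lfloor>2 ^ n * x\<rfloor> / 2 ^ n)) \<in> borel_measurable unit_leb"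
    by (rule measurable_compose[OF floor_measurable]) simp
  then show ?thesis
    by (rule measurable_cong[THEN iffD1, rotated]) (metis dyadic_step_eq assms space_unit_leb)
qed

lemma dyadic_step_bounded:
  assumes "dyadic_step n X"
  obtains B where "0 < B" "\<And>x. x \<in> {0..<1} \<Longrightarrow> \<bar>X x\<bar> \<le> B"
proof
  let ?B = "1 + (\<Sum>k\<in>{0..<2 ^ n}. \<bar>X (real_of_int k / 2 ^ n)\<bar>)"
  show "0 < ?B" by (smt (verit) sum_nonneg abs_ge_zero)
  fix x :: real assume x: "x \<in> {0..<1}"
  have "\<bar>X (real_of_int \<lfloor>2 ^ n * x\<rfloor> / 2 ^ n)\<bar> \<le> (\<Sum>k\<in>{0..<2 ^ n}. \<bar>X (real_of_int k / 2 ^ n)\<bar>)"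
    using floor_range[of x n] x by (intro member_le_sum) auto
  then show "\<bar>X x\<bar> \<le> ?B"
    using dyadic_step_eq[OF assms x] by simp
qed

lemma integrable_bounded_unit_leb:
  fixes X :: "real \<Rightarrow> real"
  assumes "X \<in> borel_measurable unit_leb" "\<And>x. x \<in> {0..<1} \<Longrightarrow> \<bar>X x\<bar> \<le> B"
  shows "integrable unit_leb X"
proof -
  interpret finite_measure unit_leb by (rule finite_measure_unit_leb)
  show ?thesis
    by (rule integrable_const_bound[where B = B]) (use assms in \<open>auto intro!: AE_I2\<close>)
qed

lemma dyadic_step_integrable:
  assumes "dyadic_step n X"
  shows "integrable unit_leb X"
  by (rule dyadic_step_bounded[OF assms], rule integrable_bounded_unit_leb)
     (use dyadic_step_measurable[OF assms] in auto)

lemma integrable_mult_bounded_unit_leb: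
  fixes X f :: "real \<Rightarrow> real"
  assumes "integrable unit_leb f" "X \<in> borel_measurable unit_leb"
    "\<And>x. x \<in> {0..<1} \<Longrightarrow> \<bar>X x\<bar> \<le> B"
  shows "integrable unit_leb (\<lambda>x. f x * X x)"
proof (rule Bochner_Integration.integrable_bound)
  show "integrable unit_leb (\<lambda>x. B * f x)" using assms by simp
  show "(\<lambda>x. f x * X x) \<in> borel_measurable unit_leb"
    using assms borel_measurable_integrable by measurable
  show "AE x in unit_leb. norm (f x * X x) \<le> norm (B * f x)"
  proof (rule AE_I2)
    fix x assume "x \<in> space unit_leb"
    then have "\<bar>X x\<bar> \<le> \<bar>B\<bar>" using assms(3)[of x] by auto
    then show "norm (f x * X x) \<le> norm (B * f x)"
      by (simp add: abs_mult mult.commute mult_right_mono)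
  qed
qed

lemma dyadic_step_integrable_mult:
  assumes "integrable unit_leb f" "dyadic_step n X"
  shows "integrable unit_leb (\<lambda>x. f x * X x)"
  by (rule dyadic_step_bounded[OF assms(2)], rule integrable_mult_bounded_unit_leb)
     (use assms dyadic_step_measurable in auto)

lemma dyadic_step_integrable_mult':
  assumes "integrable unit_leb f" "dyadic_step n X"
  shows "integrable unit_leb (\<lambda>x. X x * f x)"
  using dyadic_step_integrable_mult[OF assms] by (simp add: mult.commute)

lemma integral_mult_dyadic_step:
  assumes f: "integrable unit_leb f" and X: "dyadic_step n X"
  shows "(\<integral>x. f x * X x \<partial>unit_leb) =
    (\<Sum>k\<in>{0..<2 ^ n}. X (real_of_int k / 2 ^ n) * (\<integral>x. f x * indicator (dyadic_cell n k) x \<partial>unit_leb))"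
proof -
  have "(\<integral>x. f x * X x \<partial>unit_leb) =
    (\<integral>x. (\<Sum>k\<in>{0..<2 ^ n}. X (real_of_int k / 2 ^ n) * (f x * indicator (dyadic_cell n k) x)) \<partial>unit_leb)"
  proof (intro Bochner_Integration.integral_cong refl)
    fix x assume "x \<in> space unit_leb"
    then have x: "x \<in> {0..<1}" by simp
    have "(\<Sum>k\<in>{0..<2 ^ n}. X (real_of_int k / 2 ^ n) * (f x * indicator (dyadic_cell n k) x)) =
      (\<Sum>k\<in>{0..<2 ^ n}. if k = \<lfloor>2 ^ n * x\<rfloor> then X (real_of_int k / 2 ^ n) * f x else 0)"
      using x by (intro sum.cong) (auto simp: dyadic_cell_def indicator_def)
    also have "\<dots> = X x * f x"
      using floor_range[of x n] x by (subst sum.delta) (auto simp: dyadic_step_eq[OF X x, symmetric])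
    finally show "f x * X x = (\<Sum>k\<in>{0..<2 ^ n}. X (real_of_int k / 2 ^ n) * (f x * indicator (dyadic_cell n k) x))"
      by simp
  qed
  also have "\<dots> = (\<Sum>k\<in>{0..<2 ^ n}. X (real_of_int k / 2 ^ n) * (\<integral>x. f x * indicator (dyadic_cell n k) x \<partial>unit_leb))"
    by (subst Bochner_Integration.integral_sum)
       (auto intro!: integrable_mult_right integrable_real_mult_indicator f)
  finally show ?thesis .
qed

text \<open>The defining property of conditional expectation; all orthogonality arguments below reduce
to it.\<close>

lemma integral_dyadic_avg:
  assumes f: "integrable unit_leb f" and X: "dyadic_step n X"
  shows "(\<integral>x. dyadic_avg n f x * X x \<partial>unit_leb) = (\<integral>x. f x * X x \<partial>unit_leb)"
proof -
  have "(\<integral>x. dyadic_avg n f x * indicator (dyadic_cell n k) x \<partial>unit_leb) =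
        (\<integral>x. f x * indicator (dyadic_cell n k) x \<partial>unit_leb)" if k: "k \<in> {0..<2 ^ n}" for k
  proof -
    have "(\<integral>x. dyadic_avg n f x * indicator (dyadic_cell n k) x \<partial>unit_leb) =
      (\<integral>x. dyadic_avg n f (real_of_int k / 2 ^ n) * indicator (dyadic_cell n k) x \<partial>unit_leb)"
    proof (intro Bochner_Integration.integral_cong refl)
      fix x assume "x \<in> space unit_leb"
      then show "dyadic_avg n f x * indicator (dyadic_cell n k) x =
          dyadic_avg n f (real_of_int k / 2 ^ n) * indicator (dyadic_cell n k) x"
        using dyadic_step_eq[OF dyadic_step_avg, of x n f] by (cases "\<lfloor>2 ^ n * x\<rfloor> = k") (auto simp: dyadic_cell_def)
    qed
    also have "\<dots> = dyadic_avg n f (real_of_int k / 2 ^ n) * (1 / 2 ^ n)"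
      using dyadic_cell_measure[OF k] by (simp add: dyadic_cell_Int)
    also have "\<dots> = (\<integral>x. f x * indicator (dyadic_cell n k) x \<partial>unit_leb)"
      using dyadic_cell_left_endpoint(2)[OF k] unfolding dyadic_avg_def by simp
    finally show ?thesis .
  qed
  then show ?thesis
    unfolding integral_mult_dyadic_step[OF f X]
      integral_mult_dyadic_step[OF dyadic_step_integrable[OF dyadic_step_avg] X]
    by (intro sum.cong refl) (simp only:)
qed

lemma dyadic_avg_mult_step:
  assumes X: "dyadic_step n X" and x: "x \<in> {0..<1}"
  shows "dyadic_avg n (\<lambda>y. f y * X y) x = dyadic_avg n f x * X x"
proof -
  have "(\<integral>y. f y * X y * indicator (dyadic_cell n \<lfloor>2 ^ n * x\<rfloor>) y \<partial>unit_leb) =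
    (\<integral>y. X x * (f y * indicator (dyadic_cell n \<lfloor>2 ^ n * x\<rfloor>) y) \<partial>unit_leb)"
  proof (intro Bochner_Integration.integral_cong refl)
    fix y assume "y \<in> space unit_leb"
    then have "X y = X x" if "\<lfloor>2 ^ n * y\<rfloor> = \<lfloor>2 ^ n * x\<rfloor>"
      using that X x unfolding dyadic_step_def space_unit_leb by blast
    then show "f y * X y * indicator (dyadic_cell n \<lfloor>2 ^ n * x\<rfloor>) y =
      X x * (f y * indicator (dyadic_cell n \<lfloor>2 ^ n * x\<rfloor>) y)"
      by (cases "\<lfloor>2 ^ n * y\<rfloor> = \<lfloor>2 ^ n * x\<rfloor>") (simp_all add: dyadic_cell_def)
  qed
  then show ?thesis unfolding dyadic_avg_def by simp
qed

lemma dyadic_avg_const: "x \<in> {0..<1} \<Longrightarrow> dyadic_avg n (\<lambda>y. c) x = c"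
  using dyadic_cell_measure[OF floor_range, of x n]
  by (simp add: dyadic_avg_def dyadic_cell_Int)

lemma dyadic_avg_step: "dyadic_step n X \<Longrightarrow> x \<in> {0..<1} \<Longrightarrow> dyadic_avg n X x = X x"
  using dyadic_avg_mult_step[of n X x "\<lambda>_. 1"] by (simp add: dyadic_avg_const)

lemma dyadic_avg_mono:
  assumes "integrable unit_leb f" "integrable unit_leb g" "AE y in unit_leb. y \<in> dyadic_cell n \<lfloor>2 ^ n * x\<rfloor> \<longrightarrow> f y \<le> g y"
  shows "dyadic_avg n f x \<le> dyadic_avg n g x"
  unfolding dyadic_avg_def using assms
  by (intro mult_left_mono integral_mono_AE integrable_real_mult_indicator)
     (auto simp: indicator_def elim!: eventually_mono)

lemma dyadic_avg_nonneg: "(\<And>y. y \<in> {0..<1} \<Longrightarrow> 0 \<le> f y) \<Longrightarrow> 0 \<le> dyadic_avg n f x"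
  unfolding dyadic_avg_def by (intro mult_nonneg_nonneg integral_nonneg_AE AE_I2) auto

lemma dyadic_avg_add:
  assumes "integrable unit_leb f" "integrable unit_leb g"
  shows "dyadic_avg n (\<lambda>y. f y + g y) x = dyadic_avg n f x + dyadic_avg n g x"
  unfolding dyadic_avg_def using assms
  by (subst distrib_left[symmetric], subst Bochner_Integration.integral_add[symmetric])
     (auto intro!: integrable_real_mult_indicator simp: algebra_simps)

lemma dyadic_avg_cmult: "dyadic_avg n (\<lambda>y. c * f y) x = c * dyadic_avg n f x"
  unfolding dyadic_avg_def by (simp add: mult.assoc)

lemma abs_dyadic_avg_le: "\<bar>dyadic_avg n f x\<bar> \<le> dyadic_avg n (\<lambda>y. \<bar>f y\<bar>) x"
proof -
  let ?I = "indicator (dyadic_cell n \<lfloor>2 ^ n * x\<rfloor>) :: real \<Rightarrow> real"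
  have "\<bar>\<integral>y. f y * ?I y \<partial>unit_leb\<bar> \<le> (\<integral>y. \<bar>f y * ?I y\<bar> \<partial>unit_leb)"
    by (rule integral_abs_bound)
  then show ?thesis
    unfolding dyadic_avg_def by (simp add: abs_mult)
qed

text \<open>The averages of a nonnegative function at most double from one generation to the next. This
regularity of the dyadic filtration is what makes the weighted square function estimate work.\<close>

lemma dyadic_avg_Suc_le:
  assumes f: "integrable unit_leb f" and nn: "\<And>y. y \<in> {0..<1} \<Longrightarrow> 0 \<le> f y"
  shows "dyadic_avg (Suc n) f x \<le> 2 * dyadic_avg n f x"
proof -
  have "dyadic_cell (Suc n) \<lfloor>2 ^ Suc n * x\<rfloor> \<subseteq> dyadic_cell n \<lfloor>2 ^ n * x\<rfloor>"
    unfolding dyadic_cell_def using floor_Suc_div[of n] by (metis (mono_tags, lifting) Collect_mono)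
  then have "(\<integral>y. f y * indicator (dyadic_cell (Suc n) \<lfloor>2 ^ Suc n * x\<rfloor>) y \<partial>unit_leb) \<le>
        (\<integral>y. f y * indicator (dyadic_cell n \<lfloor>2 ^ n * x\<rfloor>) y \<partial>unit_leb)"
    by (intro integral_mono integrable_real_mult_indicator f mult_left_mono)
       (auto simp: nn indicator_def)
  then show ?thesis unfolding dyadic_avg_def by simp
qed

section \<open>Walsh functions\<close>

lemma rademacher_step: "dyadic_step (Suc n) (rademacher n)"
proof -
  have "(frac (2 ^ n * x) < 1/2) = even \<lfloor>2 ^ Suc n * x :: real\<rfloor>" for x
    unfolding floor_Suc by auto
  then show ?thesis unfolding dyadic_step_def rademacher_def rademacher_base_def by simp
qed

lemma rademacher_sq: "rademacher n x * rademacher n x = 1"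
  unfolding rademacher_def rademacher_base_def by auto

lemma walsh_sq: "walsh n x * walsh n x = 1"
  unfolding walsh_def prod.distrib[symmetric] by (simp add: rademacher_sq)

lemma abs_walsh [simp]: "\<bar>walsh n x\<bar> = 1"
  using walsh_sq[of n x] by (simp add: abs_square_eq_1[symmetric] power2_eq_square)

lemma bit_imp_index_less: "n < 2 ^ N \<Longrightarrow> bit n k \<Longrightarrow> k < N" for n :: nat
  by (metis bit_take_bit_iff take_bit_nat_eq_self)

lemma bit_add_top: "n < 2 ^ N \<Longrightarrow> bit (2 ^ N + n) k \<longleftrightarrow> k = N \<or> bit n k" for n :: nat
proof -
  assume n: "n < 2 ^ N"
  have "2 ^ N + n = or (2 ^ N) n"
    by (rule disjunctive_add_eq_or, rule bit_eqI) (use bit_imp_index_less[OF n] in \<open>auto simp: bit_simps\<close>)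
  then show ?thesis by (auto simp: bit_simps)
qed

lemma walsh_add_top:
  assumes "n < 2 ^ N"
  shows "walsh (2 ^ N + n) x = rademacher N x * walsh n x"
proof -
  have "{k. bit (2 ^ N + n) k} = insert N {k. bit n k}"
    using bit_add_top[OF assms] by auto
  moreover have "finite {k. bit n k}" "N \<notin> {k. bit n k}"
    using bit_imp_index_less[OF assms] by (auto intro: finite_subset[of _ "{..<N}"])
  ultimately show ?thesis unfolding walsh_def by simp
qed

lemma walsh_step: "n < 2 ^ N \<Longrightarrow> dyadic_step N (walsh n)"
  unfolding walsh_def[abs_def]
  by (rule dyadic_step_prod) (metis Suc_leI bit_imp_index_less dyadic_step_mono mem_Collect_eq rademacher_step)

text \<open>The \<open>n\<close>-th martingale difference of \<open>f\<close> is \<open>r\<^sub>n\<close> times the average of \<open>f r\<^sub>n\<close>: inside a cell of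
generation \<open>n\<close>, the factor \<open>1 + r\<^sub>n(x) r\<^sub>n(y)\<close> is \<open>2\<close> if \<open>y\<close> lies in the same half as \<open>x\<close> and \<open>0\<close>
otherwise.\<close>

lemma dyadic_avg_split:
  assumes f: "integrable unit_leb f" and x: "x \<in> {0..<1}"
  shows "dyadic_avg (Suc n) f x = dyadic_avg n f x + rademacher n x * dyadic_avg n (\<lambda>y. f y * rademacher n y) x"
proof -
  have fr: "integrable unit_leb (\<lambda>y. rademacher n x * (f y * rademacher n y))"
    by (intro integrable_mult_right dyadic_step_integrable_mult[OF f rademacher_step])
  have "dyadic_avg n f x + rademacher n x * dyadic_avg n (\<lambda>y. f y * rademacher n y) x
    = dyadic_avg n (\<lambda>y. f y + rademacher n x * (f y * rademacher n y)) x"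
    by (simp add: dyadic_avg_add[OF f fr] dyadic_avg_cmult)
  also have "\<dots> = 2 ^ n * (\<integral>y. 2 * (f y * indicator (dyadic_cell (Suc n) \<lfloor>2 ^ Suc n * x\<rfloor>) y) \<partial>unit_leb)"
    unfolding dyadic_avg_def
  proof (intro arg_cong[where f = "\<lambda>t. 2 ^ n * t"] Bochner_Integration.integral_cong refl)
    fix y assume "y \<in> space unit_leb"
    have "y \<in> dyadic_cell (Suc n) \<lfloor>2 ^ Suc n * x\<rfloor> \<longleftrightarrow>
      y \<in> dyadic_cell n \<lfloor>2 ^ n * x\<rfloor> \<and> (frac (2 ^ n * x) < 1 / 2 \<longleftrightarrow> frac (2 ^ n * y) < 1 / 2)"
      unfolding dyadic_cell_def floor_Suc by (auto split: if_splits; presburger)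
    then show "(f y + rademacher n x * (f y * rademacher n y)) * indicator (dyadic_cell n \<lfloor>2 ^ n * x\<rfloor>) y =
      2 * (f y * indicator (dyadic_cell (Suc n) \<lfloor>2 ^ Suc n * x\<rfloor>) y)"
      by (auto simp: indicator_def rademacher_def rademacher_base_def)
  qed
  also have "\<dots> = dyadic_avg (Suc n) f x"
    unfolding dyadic_avg_def by simp
  finally show ?thesis by simp
qed

lemma walsh_coeff_add_top:
  "n < 2 ^ N \<Longrightarrow> walsh_coeff f (2 ^ N + n) = walsh_coeff (\<lambda>y. f y * rademacher N y) n"
  unfolding walsh_coeff_def by (simp add: walsh_add_top mult.assoc)

lemma walsh_partial_sum_add_top:
  assumes "n \<le> 2 ^ N"
  shows "walsh_partial_sum (2 ^ N + n) f x =
    walsh_partial_sum (2 ^ N) f x + rademacher N x * walsh_partial_sum n (\<lambda>y. f y * rademacher N y) x"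
proof -
  have "(\<Sum>k<2 ^ N + n. walsh_coeff f k * walsh k x) =
    (\<Sum>k<2 ^ N. walsh_coeff f k * walsh k x) + (\<Sum>k<n. walsh_coeff f (2 ^ N + k) * walsh (2 ^ N + k) x)"
    unfolding lessThan_atLeast0
    by (subst sum.atLeastLessThan_concat[of 0 "2 ^ N" "2 ^ N + n", symmetric])
       (auto simp: sum.atLeastLessThan_shift_0[of _ "2 ^ N"])
  also have "(\<Sum>k<n. walsh_coeff f (2 ^ N + k) * walsh (2 ^ N + k) x) =
     rademacher N x * (\<Sum>k<n. walsh_coeff (\<lambda>y. f y * rademacher N y) k * walsh k x)"
    unfolding sum_distrib_left using assms
    by (intro sum.cong) (auto simp: walsh_coeff_add_top walsh_add_top)
  finally show ?thesis unfolding walsh_partial_sum_def .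
qed

lemma walsh_partial_sum_pow2:
  assumes "integrable unit_leb f" "x \<in> {0..<1}"
  shows "walsh_partial_sum (2 ^ N) f x = dyadic_avg N f x"
  using assms
proof (induction N arbitrary: f)
  case 0
  have "f y * indicator (dyadic_cell 0 \<lfloor>x\<rfloor>) y = f y" if "y \<in> {0..<1}" for y
    using that 0 by (auto simp: dyadic_cell_def indicator_def) (metis floor_unique of_int_0 add_0)
  then show ?case
    by (auto simp: walsh_partial_sum_def walsh_coeff_def dyadic_avg_def walsh_def
      intro!: Bochner_Integration.integral_cong)
next
  case (Suc N)
  have "walsh_partial_sum (2 ^ Suc N) f x = walsh_partial_sum (2 ^ N) f x +
      rademacher N x * walsh_partial_sum (2 ^ N) (\<lambda>y. f y * rademacher N y) x"
    using walsh_partial_sum_add_top[of "2 ^ N" N f x] by (simp add: mult_2)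
  also have "\<dots> = dyadic_avg N f x + rademacher N x * dyadic_avg N (\<lambda>y. f y * rademacher N y) x"
    using Suc.prems by (simp add: Suc.IH dyadic_step_integrable_mult[OF _ rademacher_step])
  also have "\<dots> = dyadic_avg (Suc N) f x"
    using dyadic_avg_split[OF Suc.prems] by simp
  finally show ?case .
qed

lemma walsh_partial_sum_step: "n \<le> 2 ^ N \<Longrightarrow> dyadic_step N (walsh_partial_sum n f)"
  unfolding walsh_partial_sum_def[abs_def]
  by (intro dyadic_step_sum dyadic_step_arith dyadic_step_const walsh_step) auto

text \<open>The martingale differences of \<open>f\<close> with respect to the dyadic filtration.\<close>

abbreviation dyadic_diff :: "nat \<Rightarrow> (real \<Rightarrow> real) \<Rightarrow> real \<Rightarrow> real" where
  "dyadic_diff k f x \<equiv> dyadic_avg (Suc k) f x - dyadic_avg k f x"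

text \<open>If \<open>2 ^ N\<close> is the leading power of two in \<open>m\<close>, then the \<open>N\<close>-th martingale difference of \<open>f w\<^sub>m\<close> is
\<open>w\<^sub>m\<close> times the \<open>N\<close>-th average of \<open>f\<close>.\<close>

lemma dyadic_diff_walsh_top:
  assumes f: "integrable unit_leb f" and n: "n < 2 ^ N" and x: "x \<in> {0..<1}"
  shows "dyadic_diff N (\<lambda>y. f y * walsh (2 ^ N + n) y) x = walsh (2 ^ N + n) x * dyadic_avg N f x"
proof -
  have "integrable unit_leb (\<lambda>y. f y * walsh (2 ^ N + n) y)"
    by (rule dyadic_step_integrable_mult[OF f walsh_step, of _ "Suc N"]) (use n in auto)
  from dyadic_avg_split[OF this x, of N]
  have "dyadic_diff N (\<lambda>y. f y * walsh (2 ^ N + n) y) x =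
    rademacher N x * dyadic_avg N (\<lambda>y. f y * walsh (2 ^ N + n) y * rademacher N y) x"
    by simp
  also have "(\<lambda>y. f y * walsh (2 ^ N + n) y * rademacher N y) = (\<lambda>y. f y * walsh n y)"
    using rademacher_sq[of N] by (simp add: walsh_add_top[OF n] fun_eq_iff mult.left_commute mult.commute)
  also have "rademacher N x * dyadic_avg N (\<lambda>y. f y * walsh n y) x = walsh (2 ^ N + n) x * dyadic_avg N f x"
    by (simp add: dyadic_avg_mult_step[OF walsh_step[OF n] x] walsh_add_top[OF n])
  finally show ?thesis .
qed

text \<open>After multiplication by \<open>w\<^sub>n\<close>, the partial sum operator \<open>s\<^sub>n\<close> becomes the martingale transform
that keeps exactly the differences whose index is a binary digit \<open>1\<close> of \<open>n\<close>. Here this is stated in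
bilinear form, and the proof peels off the leading digit of \<open>n\<close>.\<close>

lemma walsh_pairing:
  assumes "integrable unit_leb f" "integrable unit_leb g" "n < 2 ^ N"
  shows "(\<integral>x. walsh_partial_sum n f x * g x \<partial>unit_leb) =
    (\<Sum>k | bit n k. \<integral>x. dyadic_diff k (\<lambda>y. f y * walsh n y) x * dyadic_diff k (\<lambda>y. g y * walsh n y) x \<partial>unit_leb)"
  using assms
proof (induction N arbitrary: n f g)
  case 0
  then show ?case by (simp add: walsh_partial_sum_def)
next
  case (Suc N)
  show ?case
  proof (cases "n < 2 ^ N")
    case True
    then show ?thesis using Suc by simp
  next
    case False
    define m where "m = n - 2 ^ N"
    have n: "n = 2 ^ N + m" "m < 2 ^ N" using Suc.prems False unfolding m_def by auto
    let ?f = "\<lambda>y. f y * rademacher N y" and ?g = "\<lambda>y. g y * rademacher N y"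
    have int: "integrable unit_leb ?f" "integrable unit_leb ?g"
      using Suc.prems dyadic_step_integrable_mult[OF _ rademacher_step] by auto
    have eq: "(\<lambda>y. h y * rademacher N y * walsh m y) = (\<lambda>y. h y * walsh n y)" for h :: "real \<Rightarrow> real"
      by (simp add: n walsh_add_top mult.assoc)
    have i1: "integrable unit_leb (\<lambda>x. dyadic_avg N f x * g x)"
      by (rule dyadic_step_integrable_mult'[OF Suc.prems(2) dyadic_step_avg])
    have i2: "integrable unit_leb (\<lambda>x. walsh_partial_sum m ?f x * ?g x)"
      using dyadic_step_integrable_mult'[OF int(2) walsh_partial_sum_step[of m N]] n by simp
    have "(\<integral>x. walsh_partial_sum n f x * g x \<partial>unit_leb) =
      (\<integral>x. dyadic_avg N f x * g x + walsh_partial_sum m ?f x * ?g x \<partial>unit_leb)"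
      using n Suc.prems
      by (intro Bochner_Integration.integral_cong refl)
         (simp add: walsh_partial_sum_add_top walsh_partial_sum_pow2 distrib_right mult.assoc mult.left_commute)
    also have "\<dots> = (\<integral>x. dyadic_avg N f x * g x \<partial>unit_leb) + (\<integral>x. walsh_partial_sum m ?f x * ?g x \<partial>unit_leb)"
      by (rule Bochner_Integration.integral_add[OF i1 i2])
    also have "(\<integral>x. dyadic_avg N f x * g x \<partial>unit_leb) = (\<integral>x. dyadic_avg N g x * dyadic_avg N f x \<partial>unit_leb)"
      using integral_dyadic_avg[OF Suc.prems(2) dyadic_step_avg, of N f] by (simp add: mult.commute)
    also have "\<dots> = (\<integral>x. dyadic_diff N (\<lambda>y. f y * walsh n y) x * dyadic_diff N (\<lambda>y. g y * walsh n y) x \<partial>unit_leb)"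
    proof (intro Bochner_Integration.integral_cong refl)
      fix x assume "x \<in> space unit_leb"
      then have x: "x \<in> {0..<1}" by simp
      show "dyadic_avg N g x * dyadic_avg N f x =
        dyadic_diff N (\<lambda>y. f y * walsh n y) x * dyadic_diff N (\<lambda>y. g y * walsh n y) x"
        unfolding n(1) dyadic_diff_walsh_top[OF Suc.prems(1) n(2) x] dyadic_diff_walsh_top[OF Suc.prems(2) n(2) x]
        using walsh_sq[of "2 ^ N + m" x] by (simp add: mult.left_commute mult.commute)
    qed
    also have "(\<integral>x. walsh_partial_sum m ?f x * ?g x \<partial>unit_leb) =
      (\<Sum>k | bit m k. \<integral>x. dyadic_diff k (\<lambda>y. f y * walsh n y) x * dyadic_diff k (\<lambda>y. g y * walsh n y) x \<partial>unit_leb)"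
      using Suc.IH[OF int n(2)] by (simp add: eq)
    also have "{k. bit m k} = {k. bit n k} - {N}"
      using bit_add_top[OF n(2)] bit_imp_index_less[OF n(2)] unfolding n(1) by auto
    also have "(\<integral>x. dyadic_diff N (\<lambda>y. f y * walsh n y) x * dyadic_diff N (\<lambda>y. g y * walsh n y) x \<partial>unit_leb) +
      (\<Sum>k\<in>{k. bit n k} - {N}. \<integral>x. dyadic_diff k (\<lambda>y. f y * walsh n y) x * dyadic_diff k (\<lambda>y. g y * walsh n y) x \<partial>unit_leb)
      = (\<Sum>k | bit n k. \<integral>x. dyadic_diff k (\<lambda>y. f y * walsh n y) x * dyadic_diff k (\<lambda>y. g y * walsh n y) x \<partial>unit_leb)"
    proof (rule sum.remove[symmetric])
      show "finite {k. bit n k}" using bit_imp_index_less[OF Suc.prems(3)] by (auto intro: finite_subset[of _ "{..<Suc N}"])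
      show "N \<in> {k. bit n k}" using bit_add_top[OF n(2)] n(1) by auto
    qed
    finally show ?thesis .
  qed
qed

section \<open>The dyadic maximal function\<close>

text \<open>The maximal function up to generation \<open>n\<close>, \<open>max\<^sub>k\<^sub>\<le>\<^sub>n dyadic_avg k f\<close>. There is no absolute
value in the definition; it is applied to nonnegative functions.\<close>

primrec dyadic_max :: "nat \<Rightarrow> (real \<Rightarrow> real) \<Rightarrow> real \<Rightarrow> real" where
  "dyadic_max 0 f x = dyadic_avg 0 f x"
| "dyadic_max (Suc n) f x = max (dyadic_max n f x) (dyadic_avg (Suc n) f x)"

lemma dyadic_step_max: "dyadic_step n (dyadic_max n f)"
proof (induction n)
  case 0
  have "dyadic_max 0 f = dyadic_avg 0 f" by auto
  then show ?case using dyadic_step_avg[of 0 f] by simp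
next
  case (Suc n)
  then have "dyadic_step (Suc n) (\<lambda>x. max (dyadic_max n f x) (dyadic_avg (Suc n) f x))"
    by (intro dyadic_step_arith dyadic_step_avg dyadic_step_Suc)
  moreover have "(\<lambda>x. max (dyadic_max n f x) (dyadic_avg (Suc n) f x)) = dyadic_max (Suc n) f" by auto
  ultimately show ?case by simp
qed

lemma dyadic_avg_le_max: "dyadic_avg n f x \<le> dyadic_max n f x"
  by (cases n) auto

lemma dyadic_max_nonneg:
  assumes "\<And>y. y \<in> {0..<1} \<Longrightarrow> 0 \<le> f y"
  shows "0 \<le> dyadic_max n f x"
  using order_trans[OF dyadic_avg_nonneg[OF assms] dyadic_avg_le_max] .

lemma dyadic_max_Suc_le:
  assumes "integrable unit_leb f" "\<And>y. y \<in> {0..<1} \<Longrightarrow> 0 \<le> f y"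
  shows "dyadic_max (Suc n) f x \<le> 2 * dyadic_max n f x"
  using dyadic_avg_Suc_le[OF assms, of n x] dyadic_avg_le_max[of n f x]
    dyadic_max_nonneg[of f n x, OF assms(2)] by simp

lemma weighted_AM_GM:
  fixes a b m v :: real
  assumes "0 < m" "0 < v"
  shows "\<bar>a * b\<bar> \<le> (a\<^sup>2 * (v / m) + b\<^sup>2 * (m / v)) / 2"
proof -
  define r where "r = sqrt (v / m)"
  have r: "0 < r" "r\<^sup>2 = v / m" using assms unfolding r_def by auto
  then have r2: "(1 / r)\<^sup>2 = m / v" by (simp add: power_divide)
  have "0 \<le> (\<bar>a\<bar> * r - \<bar>b\<bar> * (1 / r))\<^sup>2" by simp
  also have "\<dots> = a\<^sup>2 * r\<^sup>2 + b\<^sup>2 * (1 / r)\<^sup>2 - 2 * \<bar>a * b\<bar>"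
    using r(1) by (simp add: power2_diff power_mult_distrib power_divide abs_mult)
  finally show ?thesis unfolding r(2) r2 by simp
qed

text \<open>The telescoping step of the weighted square function estimate. The weight \<open>v / m\<close> may
decrease when \<open>m\<close> grows to \<open>m'\<close>, and the loss is paid for by the growth of \<open>2 m v\<close>; this uses that
the dyadic maximal function at most doubles from one generation to the next.\<close>

lemma square_weight_step:
  fixes F m m' v v' :: real
  assumes "\<bar>F\<bar> \<le> m'" "0 \<le> m" "m \<le> m'" "m' \<le> 2 * m" "0 \<le> v" "v \<le> v'"
  shows "F\<^sup>2 * (v / m) + 2 * (m * v) \<le> F\<^sup>2 * (v' / m') + 2 * (m' * v')"
proof (cases "m = 0")
  case True
  then show ?thesis using assms by simp
next
  case False
  then have m: "0 < m" "0 < m'" using assms by auto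
  have "F\<^sup>2 \<le> m'\<^sup>2" using assms(1) by (metis abs_le_square_iff abs_of_pos m(2))
  then have "F\<^sup>2 / m' \<le> m'" using m by (simp add: field_simps power2_eq_square)
  also have "m' \<le> 2 * m" by fact
  finally have F: "F\<^sup>2 / m' / m \<le> 2" using m by (simp add: field_simps)
  have "F\<^sup>2 * (v / m) - F\<^sup>2 * (v / m') = (F\<^sup>2 / m' / m) * (v * (m' - m))"
    using m by (simp add: field_simps)
  also have "\<dots> \<le> 2 * (v * (m' - m))"
    using assms F by (intro mult_right_mono) auto
  finally have 1: "F\<^sup>2 * (v / m) + 2 * (m * v) \<le> F\<^sup>2 * (v / m') + 2 * (m' * v)"
    by (simp add: algebra_simps)
  have "F\<^sup>2 * (v / m') \<le> F\<^sup>2 * (v' / m')" "m' * v \<le> m' * v'"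
    using assms m by (auto intro!: mult_left_mono divide_right_mono)
  with 1 show ?thesis by linarith
qed

text \<open>Orthogonality of martingale differences, with a weight known at time \<open>k\<close>.\<close>

lemma integral_diff_square:
  assumes f: "integrable unit_leb f" and c: "dyadic_step k c"
  shows "(\<integral>x. (dyadic_diff k f x)\<^sup>2 * c x \<partial>unit_leb) =
    (\<integral>x. ((dyadic_avg (Suc k) f x)\<^sup>2 - (dyadic_avg k f x)\<^sup>2) * c x \<partial>unit_leb)"
proof -
  let ?F = "dyadic_avg k f" and ?F' = "dyadic_avg (Suc k) f"
  have Fc: "dyadic_step k (\<lambda>x. ?F x * c x)"
    by (rule dyadic_step_arith(3)[OF dyadic_step_avg c])
  have st: "dyadic_step (Suc k) (\<lambda>x. ((?F' x)\<^sup>2 - (?F x)\<^sup>2) * c x)"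
    by (intro dyadic_step_arith
        dyadic_step_map[where h = "\<lambda>t. t\<^sup>2"] dyadic_step_avg dyadic_step_Suc[OF dyadic_step_avg] dyadic_step_Suc[OF c])
  have i1: "integrable unit_leb (\<lambda>x. ?F x * (?F x * c x))"
    by (rule dyadic_step_integrable[OF dyadic_step_arith(3)[OF dyadic_step_avg Fc]])
  have i2: "integrable unit_leb (\<lambda>x. ?F' x * (?F x * c x))"
    by (rule dyadic_step_integrable[OF dyadic_step_arith(3)[OF dyadic_step_avg dyadic_step_Suc[OF Fc]]])
  have "(\<integral>x. ?F' x * (?F x * c x) \<partial>unit_leb) = (\<integral>x. ?F x * (?F x * c x) \<partial>unit_leb)"
    using integral_dyadic_avg[OF f Fc] integral_dyadic_avg[OF f dyadic_step_Suc[OF Fc]] by simp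
  then have "(\<integral>x. ((?F' x)\<^sup>2 - (?F x)\<^sup>2) * c x + 2 * (?F x * (?F x * c x) - ?F' x * (?F x * c x)) \<partial>unit_leb) =
    (\<integral>x. ((?F' x)\<^sup>2 - (?F x)\<^sup>2) * c x \<partial>unit_leb)"
    using i1 i2 dyadic_step_integrable[OF st]
    by (subst Bochner_Integration.integral_add) auto
  then show ?thesis
    by (simp add: power2_eq_square algebra_simps)
qed

text \<open>With \<open>m\<^sub>k\<close> the maximal function of \<open>\<bar>f\<bar>\<close> and \<open>v\<^sub>k\<close> any adapted nonnegative weights that increase
in \<open>k\<close>, the quantity \<open>W\<^sub>k = f\<^sub>k\<^sup>2 v\<^sub>k / m\<^sub>k + 2 m\<^sub>k v\<^sub>k\<close> has an expectation that increases at each step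
by at least the \<open>k\<close>-th term of the weighted square function. Where \<open>m\<^sub>k = 0\<close> the quotient is \<open>0\<close> by
convention, which is harmless since \<open>f\<^sub>k\<close> and all later averages vanish there.\<close>

lemma weighted_square_function:
  fixes v :: "nat \<Rightarrow> real \<Rightarrow> real"
  assumes f: "integrable unit_leb f"
    and v: "\<And>k. dyadic_step k (v k)" "\<And>k x. 0 \<le> v k x" "\<And>k x. v k x \<le> v (Suc k) x"
  defines "m \<equiv> \<lambda>k. dyadic_max k (\<lambda>y. \<bar>f y\<bar>)"
  shows "(\<Sum>k<N. \<integral>x. (dyadic_diff k f x)\<^sup>2 * (v k x / m k x) \<partial>unit_leb) \<le> 3 * (\<integral>x. m N x * v N x \<partial>unit_leb)"
proof -
  have m0: "0 \<le> m k x" for k x unfolding m_def by (rule dyadic_max_nonneg) auto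
  have mS: "m k x \<le> m (Suc k) x" "m (Suc k) x \<le> 2 * m k x" for k x
    unfolding m_def using dyadic_max_Suc_le[of "\<lambda>y. \<bar>f y\<bar>" k x] f by auto
  have Fm: "\<bar>dyadic_avg k f x\<bar> \<le> m k x" for k x
    unfolding m_def using abs_dyadic_avg_le dyadic_avg_le_max order_trans by blast
  have ms: "dyadic_step k (m k)" for k unfolding m_def by (rule dyadic_step_max)
  define W where "W k x = (dyadic_avg k f x)\<^sup>2 * (v k x / m k x) + 2 * (m k x * v k x)" for k x
  have cs: "dyadic_step k (\<lambda>x. v k x / m k x)" "dyadic_step k (\<lambda>x. m k x * v k x)" for k
    by (intro dyadic_step_arith v ms)+
  have Ws: "dyadic_step k (W k)" for k
    unfolding W_def[abs_def]
    by (intro dyadic_step_arith dyadic_step_const cs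
         dyadic_step_map[where h = "\<lambda>t. t\<^sup>2"] dyadic_step_avg v ms)
  have "(\<Sum>k<N. \<integral>x. (dyadic_diff k f x)\<^sup>2 * (v k x / m k x) \<partial>unit_leb) \<le> (\<integral>x. W N x \<partial>unit_leb)"
  proof (induction N)
    case 0
    have "0 \<le> W 0 x" for x unfolding W_def using m0 v(2) by simp
    then show ?case by simp
  next
    case (Suc k)
    have "(\<integral>x. (dyadic_diff k f x)\<^sup>2 * (v k x / m k x) \<partial>unit_leb) =
      (\<integral>x. ((dyadic_avg (Suc k) f x)\<^sup>2 - (dyadic_avg k f x)\<^sup>2) * (v k x / m k x) \<partial>unit_leb)"
      by (rule integral_diff_square[OF f cs(1)])
    also have "\<dots> \<le> (\<integral>x. W (Suc k) x - W k x \<partial>unit_leb)"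
    proof (rule integral_mono)
      show "integrable unit_leb (\<lambda>x. W (Suc k) x - W k x)"
        by (intro Bochner_Integration.integrable_diff dyadic_step_integrable[OF Ws])
      show "integrable unit_leb (\<lambda>x. ((dyadic_avg (Suc k) f x)\<^sup>2 - (dyadic_avg k f x)\<^sup>2) * (v k x / m k x))"
        by (intro dyadic_step_integrable[of "Suc k"] dyadic_step_arith
          dyadic_step_map[where h = "\<lambda>t. t\<^sup>2"] dyadic_step_avg dyadic_step_Suc[OF dyadic_step_avg] dyadic_step_Suc[OF cs(1)])
      show "((dyadic_avg (Suc k) f x)\<^sup>2 - (dyadic_avg k f x)\<^sup>2) * (v k x / m k x) \<le> W (Suc k) x - W k x" for x
        using square_weight_step[OF Fm[of "Suc k" x] m0[of k x] mS(1,2)[of k x] v(2)[of k x] v(3)[of k x]]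
        unfolding W_def left_diff_distrib by linarith
    qed
    also have "\<dots> = (\<integral>x. W (Suc k) x \<partial>unit_leb) - (\<integral>x. W k x \<partial>unit_leb)"
      by (intro Bochner_Integration.integral_diff dyadic_step_integrable[OF Ws])
    finally show ?case using Suc by simp
  qed
  also have "\<dots> \<le> (\<integral>x. 3 * (m N x * v N x) \<partial>unit_leb)"
  proof (rule integral_mono)
    show "integrable unit_leb (W N)" by (rule dyadic_step_integrable[OF Ws])
    show "integrable unit_leb (\<lambda>x. 3 * (m N x * v N x))"
      by (intro integrable_mult_right dyadic_step_integrable[OF cs(2)])
    show "W N x \<le> 3 * (m N x * v N x)" for x
    proof (cases "m N x = 0")
      case True
      then show ?thesis unfolding W_def by simp
    next
      case False
      have "(dyadic_avg N f x)\<^sup>2 \<le> (m N x)\<^sup>2" using Fm[of N x] m0[of N x] by (metis abs_le_square_iff abs_of_nonneg)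
      then have "(dyadic_avg N f x)\<^sup>2 * (v N x / m N x) \<le> (m N x)\<^sup>2 * (v N x / m N x)"
        using m0[of N x] v(2)[of N x] by (intro mult_right_mono) auto
      also have "\<dots> = m N x * v N x" using False by (simp add: power2_eq_square)
      finally show ?thesis unfolding W_def by simp
    qed
  qed
  finally show ?thesis by simp
qed

text \<open>The arithmetic-geometric mean inequality with the weight \<open>v\<^sub>k / m\<^sub>k\<close> splits each product of
differences into two squares, to which the weighted square function estimate applies with the roles
of the two maximal functions interchanged.\<close>

lemma dyadic_bilinear_bound:
  assumes f: "integrable unit_leb f" and g: "integrable unit_leb g"
  shows "(\<Sum>k<N. \<integral>x. \<bar>dyadic_diff k f x * dyadic_diff k g x\<bar> \<partial>unit_leb) \<le>
    3 * (\<integral>x. dyadic_max N (\<lambda>y. \<bar>f y\<bar>) x * dyadic_max N (\<lambda>y. \<bar>g y\<bar>) x \<partial>unit_leb)"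
proof -
  define m where "m k = dyadic_max k (\<lambda>y. \<bar>f y\<bar>)" for k
  define v where "v k = dyadic_max k (\<lambda>y. \<bar>g y\<bar>)" for k
  have nn: "0 \<le> m k x" "0 \<le> v k x" for k x unfolding m_def v_def by (rule dyadic_max_nonneg; simp)+
  have mono: "m k x \<le> m (Suc k) x" "v k x \<le> v (Suc k) x" for k x unfolding m_def v_def by auto
  have st: "dyadic_step k (m k)" "dyadic_step k (v k)" for k
    unfolding m_def v_def by (rule dyadic_step_max)+
  have zero: "dyadic_diff k h x = 0" if "integrable unit_leb h" "dyadic_max k (\<lambda>y. \<bar>h y\<bar>) x = 0" for h k x
  proof -
    have "dyadic_max (Suc k) (\<lambda>y. \<bar>h y\<bar>) x \<le> 0"
      using dyadic_max_Suc_le[of "\<lambda>y. \<bar>h y\<bar>" k x] that by simp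
    then have "\<bar>dyadic_avg (Suc k) h x\<bar> \<le> 0" "\<bar>dyadic_avg k h x\<bar> \<le> 0"
      using that(2) abs_dyadic_avg_le[of _ h x] dyadic_avg_le_max[of _ "\<lambda>y. \<bar>h y\<bar>" x] order_trans by metis+
    then show ?thesis by simp
  qed
  have ds: "dyadic_step (Suc k) (dyadic_diff k h)" for h k
    by (intro dyadic_step_arith dyadic_step_avg dyadic_step_Suc[OF dyadic_step_avg])
  have i: "integrable unit_leb (\<lambda>x. (dyadic_diff k h x)\<^sup>2 * (a x / b x))"
    if "dyadic_step k a" "dyadic_step k b" for h k a b
    by (intro dyadic_step_integrable[of "Suc k"] dyadic_step_arith
      dyadic_step_map[where h = "\<lambda>t. t\<^sup>2"] ds dyadic_step_Suc that)
  let ?A = "\<lambda>k. \<integral>x. (dyadic_diff k f x)\<^sup>2 * (v k x / m k x) \<partial>unit_leb"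
  let ?B = "\<lambda>k. \<integral>x. (dyadic_diff k g x)\<^sup>2 * (m k x / v k x) \<partial>unit_leb"
  have "(\<integral>x. \<bar>dyadic_diff k f x * dyadic_diff k g x\<bar> \<partial>unit_leb) \<le> (?A k + ?B k) / 2" for k
  proof -
    have "(\<integral>x. \<bar>dyadic_diff k f x * dyadic_diff k g x\<bar> \<partial>unit_leb) \<le>
      (\<integral>x. ((dyadic_diff k f x)\<^sup>2 * (v k x / m k x) + (dyadic_diff k g x)\<^sup>2 * (m k x / v k x)) / 2 \<partial>unit_leb)"
    proof (rule integral_mono)
      show "integrable unit_leb (\<lambda>x. \<bar>dyadic_diff k f x * dyadic_diff k g x\<bar>)"
        by (intro dyadic_step_integrable[of "Suc k"] dyadic_step_map[where h = abs] dyadic_step_arith ds)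
      show "integrable unit_leb (\<lambda>x. ((dyadic_diff k f x)\<^sup>2 * (v k x / m k x) + (dyadic_diff k g x)\<^sup>2 * (m k x / v k x)) / 2)"
        by (intro integrable_divide Bochner_Integration.integrable_add i st)
      fix x
      let ?a = "dyadic_diff k f x" and ?b = "dyadic_diff k g x"
      show "\<bar>?a * ?b\<bar> \<le> (?a\<^sup>2 * (v k x / m k x) + ?b\<^sup>2 * (m k x / v k x)) / 2"
      proof (cases "m k x = 0 \<or> v k x = 0")
        case True
        then have "?a * ?b = 0" using zero f g unfolding m_def v_def by auto
        moreover have "0 \<le> (?a\<^sup>2 * (v k x / m k x) + ?b\<^sup>2 * (m k x / v k x)) / 2"
          using nn[of k x] by simp
        ultimately show ?thesis by (simp only: abs_zero)
      next
        case False
        then have p: "0 < m k x" "0 < v k x" using nn[of k x] by auto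
        then show ?thesis using weighted_AM_GM[of "m k x" "v k x" ?a ?b] by simp
      qed
    qed
    also have "\<dots> = (?A k + ?B k) / 2"
      by (simp only: integral_divide_zero Bochner_Integration.integral_add[OF i i] st)
    finally show ?thesis .
  qed
  then have "(\<Sum>k<N. \<integral>x. \<bar>dyadic_diff k f x * dyadic_diff k g x\<bar> \<partial>unit_leb) \<le> (\<Sum>k<N. (?A k + ?B k) / 2)"
    by (rule sum_mono)
  also have "\<dots> = ((\<Sum>k<N. ?A k) + (\<Sum>k<N. ?B k)) / 2"
    by (simp add: sum.distrib sum_divide_distrib[symmetric])
  also have "\<dots> \<le> 3 * (\<integral>x. m N x * v N x \<partial>unit_leb)"
    using weighted_square_function[where v = v and N = N, OF f] weighted_square_function[where v = m and N = N, OF g] nn mono st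
    unfolding m_def[symmetric] v_def[symmetric] by (simp add: mult.commute)
  finally show ?thesis unfolding m_def v_def .
qed

lemma walsh_pairing_bound:
  assumes f: "integrable unit_leb f" and g: "integrable unit_leb g" and n: "n < 2 ^ N"
  shows "\<bar>\<integral>x. walsh_partial_sum n f x * g x \<partial>unit_leb\<bar> \<le>
    3 * (\<integral>x. dyadic_max N (\<lambda>y. \<bar>f y\<bar>) x * dyadic_max N (\<lambda>y. \<bar>g y\<bar>) x \<partial>unit_leb)"
proof -
  let ?F = "\<lambda>y. f y * walsh n y" and ?G = "\<lambda>y. g y * walsh n y"
  have int: "integrable unit_leb ?F" "integrable unit_leb ?G"
    using dyadic_step_integrable_mult[OF _ walsh_step[OF n]] f g by auto
  have "\<bar>\<integral>x. walsh_partial_sum n f x * g x \<partial>unit_leb\<bar> \<le>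
    (\<Sum>k | bit n k. \<integral>x. \<bar>dyadic_diff k ?F x * dyadic_diff k ?G x\<bar> \<partial>unit_leb)"
    unfolding walsh_pairing[OF f g n]
    by (rule order_trans[OF sum_abs]) (intro sum_mono integral_abs_bound)
  also have "\<dots> \<le> (\<Sum>k<N. \<integral>x. \<bar>dyadic_diff k ?F x * dyadic_diff k ?G x\<bar> \<partial>unit_leb)"
    using bit_imp_index_less[OF n] by (intro sum_mono2) auto
  also have "\<dots> \<le> 3 * (\<integral>x. dyadic_max N (\<lambda>y. \<bar>?F y\<bar>) x * dyadic_max N (\<lambda>y. \<bar>?G y\<bar>) x \<partial>unit_leb)"
    by (rule dyadic_bilinear_bound[OF int])
  finally show ?thesis by (simp add: abs_mult)
qed

section \<open>Doob's inequality\<close>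

text \<open>Young's inequality, arranged to bound one step of the telescoping sum for \<open>m\<^sup>s\<close>.\<close>

lemma powr_increment:
  fixes s m m' :: real
  assumes s: "1 < s" and m: "0 \<le> m" "0 \<le> m'"
  shows "m' powr s - m powr s \<le> s / (s - 1) * (m' * (m' powr (s - 1) - m powr (s - 1)))"
proof -
  have e: "m' * m' powr (s - 1) = m' powr s"
    using m by (simp add: powr_mult_base)
  have "m' * m powr (s - 1) \<le> m' powr s / s + (m powr (s - 1)) powr (s / (s - 1)) / (s / (s - 1))"
    using s m by (intro Youngs_inequality) (auto simp: field_simps)
  also have "(m powr (s - 1)) powr (s / (s - 1)) = m powr s"
    using s by (simp add: powr_powr)
  also have "m' powr s / s + m powr s / (s / (s - 1)) = m' powr s - (s - 1) / s * (m' powr s - m powr s)"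
    using s by (simp add: field_simps)
  finally have "(s - 1) / s * (m' powr s - m powr s) \<le> m' powr s - m' * m powr (s - 1)"
    by simp
  then have "s / (s - 1) * ((s - 1) / s * (m' powr s - m powr s)) \<le> s / (s - 1) * (m' powr s - m' * m powr (s - 1))"
    using s by (intro mult_left_mono) auto
  then show ?thesis using s by (simp add: e right_diff_distrib)
qed

text \<open>The maximal function increases at a step only where it coincides with the new average; there
the increment of its \<open>s\<close>-th power is controlled by this average, which may be replaced by \<open>h\<close> under
the integral.\<close>

lemma Doob_maximal_estimate:
  fixes s :: real
  assumes h: "integrable unit_leb h" and nn: "\<And>y. y \<in> {0..<1} \<Longrightarrow> 0 \<le> h y" and s: "1 < s"
  shows "(\<integral>x. dyadic_max N h x powr s \<partial>unit_leb) \<le>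
    s / (s - 1) * (\<integral>x. h x * dyadic_max N h x powr (s - 1) \<partial>unit_leb)"
proof (induction N)
  case 0
  have st: "dyadic_step 0 (\<lambda>x. dyadic_avg 0 h x powr (s - 1))"
    by (intro dyadic_step_map[where h = "\<lambda>u. u powr (s - 1)"] dyadic_step_avg)
  have "(\<integral>x. dyadic_max 0 h x powr s \<partial>unit_leb) = (\<integral>x. dyadic_avg 0 h x * dyadic_avg 0 h x powr (s - 1) \<partial>unit_leb)"
    using dyadic_avg_nonneg[OF nn] by (simp add: powr_mult_base)
  also have "\<dots> = (\<integral>x. h x * dyadic_avg 0 h x powr (s - 1) \<partial>unit_leb)"
    by (rule integral_dyadic_avg[OF h st])
  also have "\<dots> \<le> s / (s - 1) * (\<integral>x. h x * dyadic_avg 0 h x powr (s - 1) \<partial>unit_leb)"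
    using s nn by (subst mult_le_cancel_right1) (auto simp: field_simps not_less intro!: integral_nonneg_AE AE_I2)
  finally show ?case by simp
next
  case (Suc k)
  let ?m = "dyadic_max k h" and ?m' = "dyadic_max (Suc k) h"
  have m0: "0 \<le> dyadic_max j h x" for j x by (rule dyadic_max_nonneg[OF nn])
  have st: "dyadic_step (Suc k) (\<lambda>x. ?m' x powr t)" "dyadic_step (Suc k) (\<lambda>x. ?m x powr t)" for t
    by (intro dyadic_step_map[where h = "\<lambda>u. u powr t"] dyadic_step_max dyadic_step_Suc[OF dyadic_step_max])+
  have std: "dyadic_step (Suc k) (\<lambda>x. ?m' x powr t - ?m x powr t)" for t
    by (intro dyadic_step_arith st)
  have "(\<integral>x. ?m' x powr s \<partial>unit_leb) - (\<integral>x. ?m x powr s \<partial>unit_leb) = (\<integral>x. ?m' x powr s - ?m x powr s \<partial>unit_leb)"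
    by (intro Bochner_Integration.integral_diff[symmetric] dyadic_step_integrable[OF st(1)] dyadic_step_integrable[OF st(2)])
  also have "\<dots> \<le> (\<integral>x. s / (s - 1) * (dyadic_avg (Suc k) h x * (?m' x powr (s - 1) - ?m x powr (s - 1))) \<partial>unit_leb)"
  proof (rule integral_mono)
    show "integrable unit_leb (\<lambda>x. ?m' x powr s - ?m x powr s)"
      by (rule dyadic_step_integrable[OF std])
    show "integrable unit_leb (\<lambda>x. s / (s - 1) * (dyadic_avg (Suc k) h x * (?m' x powr (s - 1) - ?m x powr (s - 1))))"
      by (intro integrable_mult_right dyadic_step_integrable[OF dyadic_step_arith(3)[OF dyadic_step_avg std]])
    fix x
    show "?m' x powr s - ?m x powr s \<le> s / (s - 1) * (dyadic_avg (Suc k) h x * (?m' x powr (s - 1) - ?m x powr (s - 1)))"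
    proof (cases "?m x \<le> dyadic_avg (Suc k) h x")
      case True
      then have "?m' x = dyadic_avg (Suc k) h x" by simp
      then show ?thesis using powr_increment[OF s m0[of k x] m0[of "Suc k" x]] by simp
    next
      case False
      then have "?m' x = ?m x" by simp
      then show ?thesis by simp
    qed
  qed
  also have "\<dots> = s / (s - 1) * (\<integral>x. h x * (?m' x powr (s - 1) - ?m x powr (s - 1)) \<partial>unit_leb)"
    by (simp only: integral_mult_right_zero integral_dyadic_avg[OF h std])
  also have "(\<integral>x. h x * (?m' x powr (s - 1) - ?m x powr (s - 1)) \<partial>unit_leb) =
    (\<integral>x. h x * ?m' x powr (s - 1) \<partial>unit_leb) - (\<integral>x. h x * ?m x powr (s - 1) \<partial>unit_leb)"
    unfolding right_diff_distrib
    by (intro Bochner_Integration.integral_diff dyadic_step_integrable_mult[OF h st(1)]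
      dyadic_step_integrable_mult[OF h st(2)])
  finally show ?case using Suc by (simp only: right_diff_distrib)
qed

lemma Doob_inequality:
  fixes s :: real
  assumes s: "1 < s"
  obtains C where "0 < C" "\<And>h N. h \<in> borel_measurable unit_leb \<Longrightarrow> (\<And>y. y \<in> {0..<1} \<Longrightarrow> 0 \<le> h y) \<Longrightarrow>
    integrable unit_leb (\<lambda>x. h x powr s) \<Longrightarrow>
    (\<integral>x. dyadic_max N h x powr s \<partial>unit_leb) \<le> C * (\<integral>x. h x powr s \<partial>unit_leb)"
proof
  \<comment> \<open>The constant makes the contribution of the maximal function equal to one half of the left-hand side.\<close>
  define B where "B = 2 * (s / (s - 1))"
  have hb: "s / (s - 1) = B / 2"
    unfolding B_def by (rule nonzero_mult_div_cancel_left[symmetric]) simp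
  have B: "1 < B" using s unfolding B_def by (simp add: field_simps)
  show "0 < B * B powr (s - 1)" using B by simp
  fix h :: "real \<Rightarrow> real" and N
  assume meas: "h \<in> borel_measurable unit_leb" and nn: "\<And>y. y \<in> {0..<1} \<Longrightarrow> 0 \<le> h y"
    and int: "integrable unit_leb (\<lambda>x. h x powr s)"
  have h: "integrable unit_leb h"
  proof (rule Bochner_Integration.integrable_bound)
    show "integrable unit_leb (\<lambda>x. 1 + h x powr s)"
      using int integrable_bounded_unit_leb[of "\<lambda>_. 1" 1] by simp
    show "AE x in unit_leb. norm (h x) \<le> norm (1 + h x powr s)"
    proof (rule AE_I2)
      fix x assume "x \<in> space unit_leb"
      then have "0 \<le> h x" using nn by simp
      moreover have "h x \<le> h x powr s" if "1 \<le> h x" using powr_mono[of 1 s "h x"] s that by simp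
      ultimately show "norm (h x) \<le> norm (1 + h x powr s)"
        using powr_ge_zero[of "h x" s] unfolding real_norm_def by linarith
    qed
  qed (rule meas)
  let ?m = "dyadic_max N h"
  have m0: "0 \<le> ?m x" for x by (rule dyadic_max_nonneg[OF nn])
  have st: "dyadic_step N (\<lambda>x. ?m x powr t)" for t
    by (intro dyadic_step_map[where h = "\<lambda>u. u powr t"] dyadic_step_max)
  have "(\<integral>x. h x * ?m x powr (s - 1) \<partial>unit_leb) \<le> (\<integral>x. B powr (s - 1) * h x powr s + ?m x powr s / B \<partial>unit_leb)"
  proof (rule integral_mono)
    show "integrable unit_leb (\<lambda>x. h x * ?m x powr (s - 1))"
      by (rule dyadic_step_integrable_mult[OF h st])
    show "integrable unit_leb (\<lambda>x. B powr (s - 1) * h x powr s + ?m x powr s / B)"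
      using int dyadic_step_integrable[OF st] by simp
    fix x assume "x \<in> space unit_leb"
    then have hx: "0 \<le> h x" using nn by simp
    show "h x * ?m x powr (s - 1) \<le> B powr (s - 1) * h x powr s + ?m x powr s / B"
    proof (cases "?m x \<le> B * h x")
      case True
      have "h x * ?m x powr (s - 1) \<le> h x * (B * h x) powr (s - 1)"
        using True hx m0 s by (intro mult_left_mono powr_mono2) auto
      also have "\<dots> = B powr (s - 1) * (h x * h x powr (s - 1))"
        by (simp add: powr_mult)
      also have "h x * h x powr (s - 1) = h x powr s" using hx by (simp add: powr_mult_base)
      finally show ?thesis using B by (simp add: add_increasing2)
    next
      case False
      then have "h x * ?m x powr (s - 1) \<le> ?m x / B * ?m x powr (s - 1)"
        using B by (intro mult_right_mono) (auto simp: field_simps)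
      also have "\<dots> = ?m x powr s / B" using m0 by (simp add: powr_mult_base)
      finally show ?thesis by (simp add: add_increasing)
    qed
  qed
  also have "\<dots> = B powr (s - 1) * (\<integral>x. h x powr s \<partial>unit_leb) + (\<integral>x. ?m x powr s \<partial>unit_leb) / B"
    using int dyadic_step_integrable[OF st] by simp
  finally have *: "(\<integral>x. h x * ?m x powr (s - 1) \<partial>unit_leb) \<le>
    B powr (s - 1) * (\<integral>x. h x powr s \<partial>unit_leb) + (\<integral>x. ?m x powr s \<partial>unit_leb) / B" .
  have "(\<integral>x. ?m x powr s \<partial>unit_leb) \<le> B / 2 * (\<integral>x. h x * ?m x powr (s - 1) \<partial>unit_leb)"
    using Doob_maximal_estimate[OF h nn s, of N] unfolding hb .
  from order_trans[OF this mult_left_mono[OF *, of "B / 2"]]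
  have "(\<integral>x. ?m x powr s \<partial>unit_leb) \<le>
    B / 2 * B powr (s - 1) * (\<integral>x. h x powr s \<partial>unit_leb) + (\<integral>x. ?m x powr s \<partial>unit_leb) / 2"
    using B by (simp add: distrib_left)
  then show "(\<integral>x. ?m x powr s \<partial>unit_leb) \<le> B * B powr (s - 1) * (\<integral>x. h x powr s \<partial>unit_leb)"
    by simp
qed

section \<open>Variable exponents\<close>

text \<open>The dyadic log-Hoelder condition \<open>\<bar>A\<bar> powr (q\<^sub>-(A) - q\<^sub>+(A)) \<le> K\<close> for an exponent \<open>q\<close> with values in
\<open>[a, b]\<close>. It asks for some essential lower and upper bounds \<open>\<alpha>\<close>, \<open>\<beta>\<close> of \<open>q\<close> on each cell instead of
the essential infimum and supremum, so that it is easy to transfer to other exponents. The bounds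
\<open>a \<le> q \<le> b\<close> hold everywhere, also outside \<open>[0,1)\<close>.\<close>

definition dyadic_log_Hoelder :: "real \<Rightarrow> real \<Rightarrow> (real \<Rightarrow> real) \<Rightarrow> real \<Rightarrow> bool" where
  "dyadic_log_Hoelder a b q K \<longleftrightarrow>
     q \<in> borel_measurable unit_leb \<and> (\<forall>x. a \<le> q x \<and> q x \<le> b) \<and>
     (\<forall>n. \<forall>k\<in>{0..<2 ^ n}. \<exists>\<alpha> \<beta>. a \<le> \<alpha> \<and> \<alpha> \<le> \<beta> \<and> \<beta> \<le> b \<and> (2 ^ n) powr (\<beta> - \<alpha>) \<le> K \<and>
        (AE x in unit_leb. x \<in> dyadic_cell n k \<longrightarrow> \<alpha> \<le> q x \<and> q x \<le> \<beta>))"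

lemma dyadic_log_HoelderD:
  assumes "dyadic_log_Hoelder a b q K"
  shows "q \<in> borel_measurable unit_leb" "a \<le> q x" "q x \<le> b" "a \<le> b" "1 \<le> K"
proof -
  show "q \<in> borel_measurable unit_leb" "a \<le> q x" "q x \<le> b"
    using assms unfolding dyadic_log_Hoelder_def by auto
  then show "a \<le> b" by linarith
  obtain \<alpha> \<beta> where "(2 ^ 0) powr (\<beta> - \<alpha>) \<le> K"
    using assms unfolding dyadic_log_Hoelder_def by (metis atLeastLessThan_iff order_refl power_0 zero_less_one)
  then show "1 \<le> K" by simp
qed

lemma dyadic_log_HoelderE:
  assumes "dyadic_log_Hoelder a b q K" "k \<in> {0..<2 ^ n}"
  obtains \<alpha> \<beta> where "a \<le> \<alpha>" "\<alpha> \<le> \<beta>" "\<beta> \<le> b" "(2 ^ n) powr (\<beta> - \<alpha>) \<le> K"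
    "AE x in unit_leb. x \<in> dyadic_cell n k \<longrightarrow> \<alpha> \<le> q x \<and> q x \<le> \<beta>"
  using assms unfolding dyadic_log_Hoelder_def by blast

lemma dyadic_log_Hoelder_divide:
  assumes q: "dyadic_log_Hoelder a b q K" and s: "1 \<le> s"
  shows "dyadic_log_Hoelder (a / s) (b / s) (\<lambda>x. q x / s) K"
  unfolding dyadic_log_Hoelder_def
proof (intro conjI allI ballI)
  show "(\<lambda>x. q x / s) \<in> borel_measurable unit_leb"
    using dyadic_log_HoelderD(1)[OF q] by measurable
  show "a / s \<le> q x / s" "q x / s \<le> b / s" for x
    using dyadic_log_HoelderD(2,3)[OF q] s by (auto intro!: divide_right_mono)
  fix n :: nat and k :: int assume k: "k \<in> {0..<2 ^ n}"
  obtain \<alpha> \<beta> where ab: "a \<le> \<alpha>" "\<alpha> \<le> \<beta>" "\<beta> \<le> b" "(2 ^ n) powr (\<beta> - \<alpha>) \<le> K"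
    "AE x in unit_leb. x \<in> dyadic_cell n k \<longrightarrow> \<alpha> \<le> q x \<and> q x \<le> \<beta>"
    using dyadic_log_HoelderE[OF q k] .
  have "\<beta> / s - \<alpha> / s \<le> (\<beta> - \<alpha>) / 1"
    unfolding diff_divide_distrib[symmetric] using ab s by (intro divide_left_mono) auto
  then have "(2 ^ n) powr (\<beta> / s - \<alpha> / s) \<le> (2 ^ n) powr (\<beta> - \<alpha>)"
    by (intro powr_mono) auto
  then show "\<exists>\<alpha> \<beta>. a / s \<le> \<alpha> \<and> \<alpha> \<le> \<beta> \<and> \<beta> \<le> b / s \<and> (2 ^ n) powr (\<beta> - \<alpha>) \<le> K \<and>
        (AE x in unit_leb. x \<in> dyadic_cell n k \<longrightarrow> \<alpha> \<le> q x / s \<and> q x / s \<le> \<beta>)"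
    using ab s
    by (intro exI[of _ "\<alpha> / s"] exI[of _ "\<beta> / s"])
       (auto intro!: divide_right_mono elim!: eventually_mono)
qed

lemma conjugate_antimono:
  fixes s t :: real
  assumes "1 < s" "s \<le> t"
  shows "t / (t - 1) \<le> s / (s - 1)"
  using assms by (simp add: field_simps)

text \<open>The conjugate exponent \<open>q' = q / (q - 1)\<close> inherits the condition because \<open>t \<mapsto> t / (t - 1)\<close> has
Lipschitz constant \<open>1 / (a - 1)\<^sup>2\<close> on \<open>[a, \<infinity>)\<close>.\<close>

lemma dyadic_log_Hoelder_conjugate:
  assumes q: "dyadic_log_Hoelder a b q K" and a: "1 < a"
  shows "dyadic_log_Hoelder (b / (b - 1)) (a / (a - 1)) (\<lambda>x. q x / (q x - 1)) (K powr (1 / (a - 1)\<^sup>2))"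
  unfolding dyadic_log_Hoelder_def
proof (intro conjI allI ballI)
  note D = dyadic_log_HoelderD[OF q]
  show "(\<lambda>x. q x / (q x - 1)) \<in> borel_measurable unit_leb"
    using D(1) by measurable
  show "b / (b - 1) \<le> q x / (q x - 1)" "q x / (q x - 1) \<le> a / (a - 1)" for x
    using D(2,3)[of x] a by (auto intro!: conjugate_antimono)
  fix n :: nat and k :: int assume k: "k \<in> {0..<2 ^ n}"
  obtain \<alpha> \<beta> where ab: "a \<le> \<alpha>" "\<alpha> \<le> \<beta>" "\<beta> \<le> b" "(2 ^ n) powr (\<beta> - \<alpha>) \<le> K"
    and AE: "AE x in unit_leb. x \<in> dyadic_cell n k \<longrightarrow> \<alpha> \<le> q x \<and> q x \<le> \<beta>"
    using dyadic_log_HoelderE[OF q k] .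
  have "\<alpha> / (\<alpha> - 1) - \<beta> / (\<beta> - 1) = (\<beta> - \<alpha>) / ((\<alpha> - 1) * (\<beta> - 1))"
    using ab a by (simp add: field_simps)
  also have "\<dots> \<le> (\<beta> - \<alpha>) / ((a - 1) * (a - 1))"
    using ab a by (intro divide_left_mono mult_mono mult_pos_pos) auto
  also have "\<dots> = (\<beta> - \<alpha>) * (1 / (a - 1)\<^sup>2)" by (simp add: power2_eq_square)
  finally have "(2 ^ n) powr (\<alpha> / (\<alpha> - 1) - \<beta> / (\<beta> - 1)) \<le> ((2 ^ n) powr (\<beta> - \<alpha>)) powr (1 / (a - 1)\<^sup>2)"
    unfolding powr_powr by (intro powr_mono) auto
  also have "\<dots> \<le> K powr (1 / (a - 1)\<^sup>2)"
    using ab(4) by (intro powr_mono2) auto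
  finally have "(2 ^ n) powr (\<alpha> / (\<alpha> - 1) - \<beta> / (\<beta> - 1)) \<le> K powr (1 / (a - 1)\<^sup>2)" .
  moreover have "AE x in unit_leb. x \<in> dyadic_cell n k \<longrightarrow>
      \<beta> / (\<beta> - 1) \<le> q x / (q x - 1) \<and> q x / (q x - 1) \<le> \<alpha> / (\<alpha> - 1)"
    using AE by eventually_elim (use ab a in \<open>auto intro!: conjugate_antimono\<close>)
  ultimately show "\<exists>\<alpha> \<beta>. b / (b - 1) \<le> \<alpha> \<and> \<alpha> \<le> \<beta> \<and> \<beta> \<le> a / (a - 1) \<and>
      (2 ^ n) powr (\<beta> - \<alpha>) \<le> K powr (1 / (a - 1)\<^sup>2) \<and>
      (AE x in unit_leb. x \<in> dyadic_cell n k \<longrightarrow> \<alpha> \<le> q x / (q x - 1) \<and> q x / (q x - 1) \<le> \<beta>)"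
    using ab a
    by (intro exI[of _ "\<beta> / (\<beta> - 1)"] exI[of _ "\<alpha> / (\<alpha> - 1)"]) (auto intro!: conjugate_antimono)
qed

lemma powr_le_one_plus:
  fixes x \<alpha> \<beta> :: real
  assumes "0 \<le> x" "0 \<le> \<alpha>" "\<alpha> \<le> \<beta>"
  shows "x powr \<alpha> \<le> 1 + x powr \<beta>"
proof (cases "1 \<le> x")
  case True
  then show ?thesis using powr_mono[of \<alpha> \<beta> x] assms by simp
next
  case False
  then have "x powr \<alpha> \<le> 1" using assms by (intro powr_le1) auto
  then show ?thesis by (simp add: add_increasing2)
qed

lemma le_one_plus_powr:
  fixes x \<beta> :: real
  assumes "0 \<le> x" "1 \<le> \<beta>"
  shows "x \<le> 1 + x powr \<beta>"
  using powr_le_one_plus[of x 1 \<beta>] assms by simp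

lemma integrable_powr_mono:
  fixes f q r :: "real \<Rightarrow> real"
  assumes f: "f \<in> borel_measurable unit_leb" "\<And>x. x \<in> {0..<1} \<Longrightarrow> 0 \<le> f x"
    and r: "r \<in> borel_measurable unit_leb" "\<And>x. 0 \<le> r x" "\<And>x. r x \<le> q x"
    and int: "integrable unit_leb (\<lambda>x. f x powr q x)"
  shows "integrable unit_leb (\<lambda>x. f x powr r x)"
proof (rule Bochner_Integration.integrable_bound)
  show "integrable unit_leb (\<lambda>x. 1 + f x powr q x)"
    using int integrable_bounded_unit_leb[of "\<lambda>_. 1" 1] by simp
  show "(\<lambda>x. f x powr r x) \<in> borel_measurable unit_leb"
    using f(1) r(1) by measurable
  show "AE x in unit_leb. norm (f x powr r x) \<le> norm (1 + f x powr q x)"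
  proof (rule AE_I2)
    fix x assume "x \<in> space unit_leb"
    then have "f x powr r x \<le> 1 + f x powr q x"
      using f(2) r(2,3) by (intro powr_le_one_plus) auto
    then show "norm (f x powr r x) \<le> norm (1 + f x powr q x)"
      by (simp add: add_nonneg_nonneg)
  qed
qed

lemma powr_integrable_imp_integrable:
  fixes f q :: "real \<Rightarrow> real"
  assumes "f \<in> borel_measurable unit_leb" "\<And>x. x \<in> {0..<1} \<Longrightarrow> 0 \<le> f x" "\<And>x. 1 \<le> q x"
    and "integrable unit_leb (\<lambda>x. f x powr q x)"
  shows "integrable unit_leb f"
proof -
  have "integrable unit_leb (\<lambda>x. f x powr 1)"
    by (rule integrable_powr_mono[of f "\<lambda>_. 1" q]) (use assms in auto)
  then show ?thesis
    by (rule Bochner_Integration.integrable_cong[THEN iffD1, rotated 2]) (use assms(2) in auto)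
qed

lemma integral_unit_leb_const [simp]: "(\<integral>x. c \<partial>unit_leb) = (c :: real)"
  by simp

lemma integrable_unit_leb_const [simp]: "integrable unit_leb (\<lambda>x. c :: real)"
  by (rule integrable_bounded_unit_leb[of _ "\<bar>c\<bar>"]) auto

text \<open>The point where the log-Hoelder condition enters: a Jensen inequality with variable exponent.
With \<open>\<alpha>\<close> the lower bound of \<open>r\<close> on the cell and \<open>D\<close> the average of \<open>f\<^sup>r\<close> plus one, the
average of \<open>f\<close> is at most \<open>2 D powr (1 / \<alpha>)\<close>. Raising this to the power \<open>r(x)\<close> gives \<open>D\<close> times
\<open>D powr (r(x) / \<alpha> - 1)\<close>, and the last factor is bounded because \<open>D \<le> 3 2\<^sup>n\<close> and the oscillation of \<open>r\<close>
on the cell is controlled.\<close>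

lemma dyadic_avg_powr_le_cell:
  assumes r: "dyadic_log_Hoelder 1 R r K" and s: "1 \<le> s"
    and f: "f \<in> borel_measurable unit_leb" "\<And>x. x \<in> {0..<1} \<Longrightarrow> 0 \<le> f x"
    and int: "integrable unit_leb (\<lambda>x. f x powr (s * r x))" and le: "(\<integral>x. f x powr (s * r x) \<partial>unit_leb) \<le> 1"
    and k: "k \<in> {0..<2 ^ n}"
  shows "AE x in unit_leb. x \<in> dyadic_cell n k \<longrightarrow>
    dyadic_avg n f x powr r x \<le> 6 powr R * K * (dyadic_avg n (\<lambda>y. f y powr r y) x + 1)"
proof -
  note D = dyadic_log_HoelderD[OF r]
  obtain \<alpha> \<beta> where ab: "1 \<le> \<alpha>" "\<alpha> \<le> \<beta>" "\<beta> \<le> R" "(2 ^ n) powr (\<beta> - \<alpha>) \<le> K"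
    and AE: "AE x in unit_leb. x \<in> dyadic_cell n k \<longrightarrow> \<alpha> \<le> r x \<and> r x \<le> \<beta>"
    using dyadic_log_HoelderE[OF r k] .
  have rs: "r x \<le> s * r x" "1 \<le> s * r x" for x
    using D(2)[of x] s mult_mono[of 1 s 1 "r x"] mult_right_mono[of 1 s "r x"] by auto
  have r0: "0 \<le> r x" for x using D(2)[of x] by linarith
  let ?fr = "\<lambda>y. f y powr r y"
  have ifr: "integrable unit_leb ?fr"
    by (rule integrable_powr_mono[OF f D(1) r0 rs(1) int])
  have iF: "integrable unit_leb f"
    by (rule powr_integrable_imp_integrable[OF f rs(2) int])
  show ?thesis
    using AE
  proof (eventually_elim, intro impI)
    fix x assume AEx: "x \<in> dyadic_cell n k \<longrightarrow> \<alpha> \<le> r x \<and> r x \<le> \<beta>" and x: "x \<in> dyadic_cell n k"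
    then have rx: "\<alpha> \<le> r x" "r x \<le> \<beta>" and x01: "x \<in> {0..<1}" and kx: "\<lfloor>2 ^ n * x\<rfloor> = k"
      by (auto simp: dyadic_cell_def)
    define D where "D = dyadic_avg n ?fr x + 1"
    have D1: "1 \<le> D" unfolding D_def using dyadic_avg_nonneg[of ?fr n x] by simp
    \<comment> \<open>Either \<open>f y \<le> t\<close>, or \<open>f y / t \<le> (f y / t) powr \<alpha>\<close>; this replaces the integral Jensen inequality.\<close>
    define t where "t = D powr (1 / \<alpha>)"
    have t1: "1 \<le> t" unfolding t_def using D1 ab by (intro ge_one_powr_ge_zero) auto
    have ta: "t powr \<alpha> = D" unfolding t_def powr_powr using ab D1 by simp
    have "dyadic_avg n f x \<le> dyadic_avg n (\<lambda>y. (t + t / D) + t / D * ?fr y) x"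
    proof (rule dyadic_avg_mono[OF iF])
      show "integrable unit_leb (\<lambda>y. (t + t / D) + t / D * ?fr y)"
        using ifr by (intro Bochner_Integration.integrable_add integrable_mult_right) auto
      have "AE y in unit_leb. y \<in> {0..<1}" by (rule AE_I2) simp
      then show "AE y in unit_leb. y \<in> dyadic_cell n \<lfloor>2 ^ n * x\<rfloor> \<longrightarrow> f y \<le> (t + t / D) + t / D * ?fr y"
        unfolding kx using AE
      proof (eventually_elim, intro impI)
        fix y assume y: "y \<in> {0..<1}" "y \<in> dyadic_cell n k \<longrightarrow> \<alpha> \<le> r y \<and> r y \<le> \<beta>" "y \<in> dyadic_cell n k"
        have "f y / t \<le> 1 + (f y / t) powr \<alpha>"
          using f(2)[OF y(1)] t1 ab by (intro le_one_plus_powr) auto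
        also have "(f y / t) powr \<alpha> = f y powr \<alpha> / D"
          by (simp add: powr_divide ta)
        also have "f y powr \<alpha> \<le> 1 + ?fr y"
          using f(2)[OF y(1)] ab y by (intro powr_le_one_plus) auto
        finally have "f y / t \<le> 1 + (1 + ?fr y) / D"
          using D1 by (simp add: divide_right_mono)
        then show "f y \<le> (t + t / D) + t / D * ?fr y"
          using t1 by (simp add: divide_le_eq algebra_simps add_divide_distrib)
      qed
    qed
    also have "\<dots> = (t + t / D) + t / D * dyadic_avg n ?fr x"
    proof -
      have "integrable unit_leb (\<lambda>y. t / D * ?fr y)" using ifr by (intro integrable_mult_right) auto
      then show ?thesis
        by (simp only: dyadic_avg_add[OF integrable_unit_leb_const] dyadic_avg_cmult dyadic_avg_const[OF x01])
    qed
    also have "\<dots> = t + t / D * D"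
    proof -
      have "D = dyadic_avg n ?fr x + 1" by (simp only: D_def)
      then have "t / D * D = t / D * dyadic_avg n ?fr x + t / D"
        by (metis distrib_left mult_1_right)
      then show ?thesis by (simp only: ac_simps)
    qed
    also have "\<dots> = 2 * t" using D1 by simp
    finally have le2t: "dyadic_avg n f x \<le> 2 * t" .
    have "dyadic_avg n ?fr x \<le> 2 ^ n * 2"
      unfolding dyadic_avg_def
    proof (intro mult_left_mono)
      have "(\<integral>y. ?fr y * indicator (dyadic_cell n \<lfloor>2 ^ n * x\<rfloor>) y \<partial>unit_leb) \<le> (\<integral>y. 1 + f y powr (s * r y) \<partial>unit_leb)"
      proof (rule integral_mono)
        show "integrable unit_leb (\<lambda>y. ?fr y * indicator (dyadic_cell n \<lfloor>2 ^ n * x\<rfloor>) y)"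
          by (intro integrable_real_mult_indicator ifr dyadic_cell_measurable)
        show "integrable unit_leb (\<lambda>y. 1 + f y powr (s * r y))" using int by simp
        fix y assume "y \<in> space unit_leb"
        then have "?fr y \<le> 1 + f y powr (s * r y)"
          using f(2)[of y] rs(1)[of y] r0[of y] by (intro powr_le_one_plus) auto
        then show "?fr y * indicator (dyadic_cell n \<lfloor>2 ^ n * x\<rfloor>) y \<le> 1 + f y powr (s * r y)"
          by (auto simp: indicator_def add_nonneg_nonneg)
      qed
      also have "\<dots> \<le> 2" using int le by simp
      finally show "(\<integral>y. ?fr y * indicator (dyadic_cell n \<lfloor>2 ^ n * x\<rfloor>) y \<partial>unit_leb) \<le> 2" .
    qed simp
    then have D3: "D \<le> 3 * 2 ^ n" unfolding D_def using one_le_power[of "2::real" n] by linarith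
    have "dyadic_avg n f x powr r x \<le> (2 * t) powr r x"
      using le2t dyadic_avg_nonneg[OF f(2)] rx ab by (intro powr_mono2) auto
    also have "\<dots> = 2 powr r x * (D powr 1 * D powr (r x / \<alpha> - 1))"
      unfolding t_def powr_mult powr_powr powr_add[symmetric] by simp
    also have "\<dots> \<le> 2 powr R * (D powr 1 * (3 powr R * K))"
    proof (intro mult_mono)
      show "2 powr r x \<le> 2 powr R" using rx ab by (intro powr_mono) auto
      have e: "r x / \<alpha> - 1 \<le> \<beta> - \<alpha>"
      proof -
        have "r x / \<alpha> - 1 = (r x - \<alpha>) / \<alpha>" using ab by (simp add: field_simps)
        also have "\<dots> \<le> (r x - \<alpha>) / 1" using rx ab by (intro divide_left_mono) auto
        finally show ?thesis using rx by simp
      qed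
      have "D powr (r x / \<alpha> - 1) \<le> D powr (\<beta> - \<alpha>)" using D1 e by (intro powr_mono) auto
      also have "\<dots> \<le> (3 * 2 ^ n) powr (\<beta> - \<alpha>)" using D1 D3 ab by (intro powr_mono2) auto
      also have "\<dots> = 3 powr (\<beta> - \<alpha>) * (2 ^ n) powr (\<beta> - \<alpha>)" by (simp add: powr_mult)
      also have "\<dots> \<le> 3 powr R * K" using ab by (intro mult_mono powr_mono) auto
      finally show "D powr (r x / \<alpha> - 1) \<le> 3 powr R * K" .
    qed (use D1 in auto)
    also have "\<dots> = (2 powr R * 3 powr R) * K * D" using D1 by simp
    also have "2 powr R * 3 powr R = (6::real) powr R" by (simp add: powr_mult[symmetric])
    finally show "dyadic_avg n f x powr r x \<le> 6 powr R * K * (dyadic_avg n ?fr x + 1)"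
      unfolding D_def .
  qed
qed

lemma dyadic_max_powr_le:
  assumes r: "dyadic_log_Hoelder 1 R r K" and s: "1 \<le> s"
    and f: "f \<in> borel_measurable unit_leb" "\<And>x. x \<in> {0..<1} \<Longrightarrow> 0 \<le> f x"
    and int: "integrable unit_leb (\<lambda>x. f x powr (s * r x))" and le: "(\<integral>x. f x powr (s * r x) \<partial>unit_leb) \<le> 1"
  shows "AE x in unit_leb. dyadic_max N f x powr r x \<le> 6 powr R * K * (dyadic_max N (\<lambda>y. f y powr r y) x + 1)"
proof -
  let ?C = "6 powr R * K" and ?fr = "\<lambda>y. f y powr r y"
  have C: "0 \<le> ?C" using dyadic_log_HoelderD(5)[OF r] by simp
  have "AE x in unit_leb. x \<in> {0..<1}" by (rule AE_I2) simp
  moreover have "AE x in unit_leb. \<forall>n. \<forall>k\<in>{0..<2 ^ n}. x \<in> dyadic_cell n k \<longrightarrow>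
      dyadic_avg n f x powr r x \<le> ?C * (dyadic_avg n ?fr x + 1)"
    by (intro AE_all_countable[THEN iffD2] allI AE_ball_countable[THEN iffD2] ballI dyadic_avg_powr_le_cell[OF r s f int le])
       auto
  ultimately show ?thesis
  proof eventually_elim
    fix x :: real
    assume x: "x \<in> {0..<1}" and *: "\<forall>n. \<forall>k\<in>{0..<2 ^ n}. x \<in> dyadic_cell n k \<longrightarrow>
      dyadic_avg n f x powr r x \<le> ?C * (dyadic_avg n ?fr x + 1)"
    have step: "dyadic_avg n f x powr r x \<le> ?C * (dyadic_max m ?fr x + 1)" if "dyadic_avg n ?fr x \<le> dyadic_max m ?fr x" for n m
    proof -
      have "\<lfloor>2 ^ n * x\<rfloor> \<in> {0..<2 ^ n}" "x \<in> dyadic_cell n \<lfloor>2 ^ n * x\<rfloor>"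
        using floor_range x by (auto simp: dyadic_cell_def)
      then have "dyadic_avg n f x powr r x \<le> ?C * (dyadic_avg n ?fr x + 1)" using * by blast
      also have "\<dots> \<le> ?C * (dyadic_max m ?fr x + 1)"
        using that C by (intro mult_left_mono) auto
      finally show ?thesis .
    qed
    show "dyadic_max N f x powr r x \<le> ?C * (dyadic_max N ?fr x + 1)"
    proof (induction N)
      case 0
      show ?case using step[of 0 0] by simp
    next
      case (Suc N)
      show ?case
      proof (cases "dyadic_max N f x \<le> dyadic_avg (Suc N) f x")
        case True
        then have "dyadic_max (Suc N) f x = dyadic_avg (Suc N) f x" by simp
        then show ?thesis using step[OF dyadic_avg_le_max, of "Suc N"] by (simp only:)
      next
        case False
        then have "dyadic_max (Suc N) f x = dyadic_max N f x" by simp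
        then have "dyadic_max (Suc N) f x powr r x \<le> ?C * (dyadic_max N ?fr x + 1)" using Suc by (simp only:)
        also have "\<dots> \<le> ?C * (dyadic_max (Suc N) ?fr x + 1)" using C by (intro mult_left_mono) auto
        finally show ?thesis .
      qed
    qed
  qed
qed

lemma integrable_powr_bounded:
  fixes X q :: "real \<Rightarrow> real"
  assumes X: "X \<in> borel_measurable unit_leb" "\<And>x. x \<in> {0..<1} \<Longrightarrow> 0 \<le> X x" "\<And>x. x \<in> {0..<1} \<Longrightarrow> X x \<le> B"
    and q: "q \<in> borel_measurable unit_leb" "\<And>x. 0 \<le> q x" "\<And>x. q x \<le> b"
  shows "integrable unit_leb (\<lambda>x. X x powr q x)"
proof (rule integrable_bounded_unit_leb)
  show "(\<lambda>x. X x powr q x) \<in> borel_measurable unit_leb" using X(1) q(1) by measurable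
  fix x :: real assume x: "x \<in> {0..<1}"
  have "X x powr q x \<le> (1 + B) powr q x"
    using X(2,3)[OF x] q(2)[of x] by (intro powr_mono2) auto
  also have "\<dots> \<le> (1 + B) powr b"
    using X(2,3)[OF x] q(3)[of x] by (intro powr_mono) auto
  finally show "\<bar>X x powr q x\<bar> \<le> (1 + B) powr b" by simp
qed

lemma integrable_powr_step:
  fixes q :: "real \<Rightarrow> real"
  assumes X: "dyadic_step n X" "\<And>x. x \<in> {0..<1} \<Longrightarrow> 0 \<le> X x"
    and q: "q \<in> borel_measurable unit_leb" "\<And>x. 0 \<le> q x" "\<And>x. q x \<le> b"
  shows "integrable unit_leb (\<lambda>x. X x powr q x)"
proof -
  obtain B where "\<And>x. x \<in> {0..<1} \<Longrightarrow> \<bar>X x\<bar> \<le> B"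
    using dyadic_step_bounded[OF X(1)] by blast
  then have "X x \<le> B" if "x \<in> {0..<1}" for x using that by (auto dest: abs_le_D1)
  then show ?thesis
    by (intro integrable_powr_bounded[OF dyadic_step_measurable[OF X(1)] X(2) _ q])
qed

text \<open>Boundedness of the maximal operator in modular form. The exponent is split as \<open>q = a r\<close> with
\<open>r \<ge> 1\<close>: the factor \<open>r\<close> is absorbed by the pointwise estimate, and Doob's inequality is applied with
the constant exponent \<open>a > 1\<close>.\<close>

lemma dyadic_max_modular_bound:
  assumes q: "dyadic_log_Hoelder a b q K" and a: "1 < a"
  obtains C where "\<And>f N. f \<in> borel_measurable unit_leb \<Longrightarrow> (\<And>x. x \<in> {0..<1} \<Longrightarrow> 0 \<le> f x) \<Longrightarrow>
    integrable unit_leb (\<lambda>x. f x powr q x) \<Longrightarrow> (\<integral>x. f x powr q x \<partial>unit_leb) \<le> 1 \<Longrightarrow>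
    (\<integral>x. dyadic_max N f x powr q x \<partial>unit_leb) \<le> C"
proof -
  obtain C where C: "0 < C" "\<And>h N. h \<in> borel_measurable unit_leb \<Longrightarrow> (\<And>y. y \<in> {0..<1} \<Longrightarrow> 0 \<le> h y) \<Longrightarrow>
    integrable unit_leb (\<lambda>x. h x powr a) \<Longrightarrow>
    (\<integral>x. dyadic_max N h x powr a \<partial>unit_leb) \<le> C * (\<integral>x. h x powr a \<partial>unit_leb)"
    using Doob_inequality[OF a] by blast
  define r where "r x = q x / a" for x
  have r: "dyadic_log_Hoelder 1 (b / a) r K"
    using dyadic_log_Hoelder_divide[OF q, of a] a unfolding r_def[abs_def] by simp
  have qr: "q x = a * r x" for x using a unfolding r_def by simp
  note D = dyadic_log_HoelderD[OF q]
  have q0: "0 \<le> q x" for x using D(2)[of x] a by linarith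
  define A where "A = 6 powr (b / a) * K"
  have A: "0 \<le> A" unfolding A_def using D(5) by simp
  show ?thesis
  proof (rule that)
    fix f :: "real \<Rightarrow> real" and N
    assume f: "f \<in> borel_measurable unit_leb" "\<And>x. x \<in> {0..<1} \<Longrightarrow> 0 \<le> f x"
      and int: "integrable unit_leb (\<lambda>x. f x powr q x)" and le: "(\<integral>x. f x powr q x \<partial>unit_leb) \<le> 1"
    let ?fr = "\<lambda>y. f y powr r y"
    let ?M = "dyadic_max N ?fr"
    have M0: "0 \<le> ?M x" for x by (rule dyadic_max_nonneg) simp
    have m0: "0 \<le> dyadic_max N f x" for x by (rule dyadic_max_nonneg[OF f(2)])
    have frm: "?fr \<in> borel_measurable unit_leb"
      using f(1) dyadic_log_HoelderD(1)[OF r] by measurable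
    have frq: "?fr x powr a = f x powr q x" for x
      unfolding powr_powr qr by (simp add: mult.commute)
    have iM: "integrable unit_leb (\<lambda>x. ?M x powr a)"
      by (intro dyadic_step_integrable[of N] dyadic_step_map[where h = "\<lambda>u. u powr a"] dyadic_step_max)
    have "(\<integral>x. dyadic_max N f x powr q x \<partial>unit_leb) \<le> (\<integral>x. (2 * A) powr a * (1 + ?M x powr a) \<partial>unit_leb)"
    proof (rule integral_mono_AE)
      show "integrable unit_leb (\<lambda>x. dyadic_max N f x powr q x)"
        by (rule integrable_powr_step[OF dyadic_step_max m0 D(1) q0 D(3)])
      show "integrable unit_leb (\<lambda>x. (2 * A) powr a * (1 + ?M x powr a))"
        using iM by simp
      have "AE x in unit_leb. dyadic_max N f x powr r x \<le> A * (?M x + 1)"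
        unfolding A_def using a int le unfolding qr
        by (intro dyadic_max_powr_le[where s = a] r f) auto
      then show "AE x in unit_leb. dyadic_max N f x powr q x \<le> (2 * A) powr a * (1 + ?M x powr a)"
      proof eventually_elim
        fix x assume *: "dyadic_max N f x powr r x \<le> A * (?M x + 1)"
        have "dyadic_max N f x powr q x = (dyadic_max N f x powr r x) powr a"
          unfolding powr_powr qr by (simp add: mult.commute)
        also have "\<dots> \<le> (A * (?M x + 1)) powr a" using * a by (intro powr_mono2) auto
        also have "\<dots> \<le> (2 * A * max 1 (?M x)) powr a"
        proof (intro powr_mono2)
          have "A * (?M x + 1) \<le> A * (2 * max 1 (?M x))" using A by (intro mult_left_mono) auto
          then show "A * (?M x + 1) \<le> 2 * A * max 1 (?M x)" by (simp only: mult.assoc mult.left_commute)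
        qed (use A a M0[of x] in auto)
        also have "\<dots> = (2 * A) powr a * max 1 (?M x) powr a" by (simp add: powr_mult)
        also have "\<dots> \<le> (2 * A) powr a * (1 + ?M x powr a)"
          by (intro mult_left_mono) (auto simp: max_def)
        finally show "dyadic_max N f x powr q x \<le> (2 * A) powr a * (1 + ?M x powr a)" .
      qed
    qed
    also have "\<dots> = (2 * A) powr a * (1 + (\<integral>x. ?M x powr a \<partial>unit_leb))" using iM by simp
    also have "\<dots> \<le> (2 * A) powr a * (1 + C * 1)"
    proof -
      have "(\<integral>x. ?M x powr a \<partial>unit_leb) \<le> C * (\<integral>x. ?fr x powr a \<partial>unit_leb)"
        using int by (intro C(2) frm) (auto simp: frq)
      also have "\<dots> \<le> C * 1" unfolding frq using C(1) le by (intro mult_left_mono) auto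
      finally show ?thesis by (intro mult_left_mono) auto
    qed
    finally show "(\<integral>x. dyadic_max N f x powr q x \<partial>unit_leb) \<le> (2 * A) powr a * (1 + C * 1)" .
  qed
qed

section \<open>Uniform boundedness of the partial sums\<close>

lemma mult_le_powr_conjugate:
  fixes u v p :: real
  assumes "0 \<le> u" "0 \<le> v" "1 < p"
  shows "u * v \<le> u powr p + v powr (p / (p - 1))"
proof (cases "v \<le> u powr (p - 1)")
  case True
  then have "u * v \<le> u * u powr (p - 1)" using assms by (intro mult_left_mono) auto
  also have "\<dots> = u powr p" using assms by (simp add: powr_mult_base)
  finally show ?thesis by (simp add: add_increasing2)
next
  case False
  then have "(u powr (p - 1)) powr (1 / (p - 1)) \<le> v powr (1 / (p - 1))"
    using assms by (intro powr_mono2) auto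
  then have "u \<le> v powr (1 / (p - 1))" using assms by (simp add: powr_powr)
  then have "u * v \<le> v * v powr (1 / (p - 1))" using assms mult_right_mono[of u "v powr (1 / (p - 1))" v] by (simp only: mult.commute)
  also have "\<dots> = v powr (1 + 1 / (p - 1))" using assms by (simp add: powr_mult_base)
  also have "1 + 1 / (p - 1) = p / (p - 1)" using assms by (simp add: field_simps)
  finally show ?thesis by (simp add: add_increasing)
qed

text \<open>The partial sum operators are uniformly bounded. The proof is by duality: for \<open>h = s\<^sub>n f\<close>, the
function \<open>g = sgn h (\<bar>h\<bar> / \<mu>) powr (p - 1)\<close> has conjugate modular equal to the modular of \<open>h / \<mu>\<close>, and
\<open>\<mu>\<close> times this modular is the integral of \<open>h g\<close>, which is bounded by maximal functions.\<close>

lemma walsh_partial_sum_bounded: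
  assumes p: "dyadic_log_Hoelder a b p K" and a: "1 < a"
  obtains L where "1 \<le> L" "\<And>f n. f \<in> borel_measurable unit_leb \<Longrightarrow>
    integrable unit_leb (\<lambda>x. \<bar>f x\<bar> powr p x) \<Longrightarrow> (\<integral>x. \<bar>f x\<bar> powr p x \<partial>unit_leb) \<le> 1 \<Longrightarrow>
    (\<integral>x. (\<bar>walsh_partial_sum n f x\<bar> / L) powr p x \<partial>unit_leb) \<le> 1"
proof -
  note D = dyadic_log_HoelderD[OF p]
  have p1: "1 < p x" "0 \<le> p x" "1 \<le> p x" for x using D(2)[of x] a by auto
  let ?q = "\<lambda>x. p x / (p x - 1)"
  have q: "dyadic_log_Hoelder (b / (b - 1)) (a / (a - 1)) ?q (K powr (1 / (a - 1)\<^sup>2))"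
    by (rule dyadic_log_Hoelder_conjugate[OF p a])
  note Dq = dyadic_log_HoelderD[OF q]
  have q0: "0 \<le> ?q x" for x using p1[of x] by simp
  have b: "1 < b / (b - 1)" using a D(4) by (simp add: field_simps)
  obtain C where C: "\<And>f N. f \<in> borel_measurable unit_leb \<Longrightarrow> (\<And>x. x \<in> {0..<1} \<Longrightarrow> 0 \<le> f x) \<Longrightarrow>
    integrable unit_leb (\<lambda>x. f x powr p x) \<Longrightarrow> (\<integral>x. f x powr p x \<partial>unit_leb) \<le> 1 \<Longrightarrow>
    (\<integral>x. dyadic_max N f x powr p x \<partial>unit_leb) \<le> C"
    using dyadic_max_modular_bound[OF p a] by blast
  obtain C' where C': "\<And>f N. f \<in> borel_measurable unit_leb \<Longrightarrow> (\<And>x. x \<in> {0..<1} \<Longrightarrow> 0 \<le> f x) \<Longrightarrow>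
    integrable unit_leb (\<lambda>x. f x powr ?q x) \<Longrightarrow> (\<integral>x. f x powr ?q x \<partial>unit_leb) \<le> 1 \<Longrightarrow>
    (\<integral>x. dyadic_max N f x powr ?q x \<partial>unit_leb) \<le> C'"
    using dyadic_max_modular_bound[OF q b] by blast
  define L where "L = max 1 (2 powr b * (3 * (C + C')))"
  show ?thesis
  proof (rule that)
    show L1: "1 \<le> L" unfolding L_def by simp
    fix f :: "real \<Rightarrow> real" and n :: nat
    assume f: "f \<in> borel_measurable unit_leb" and int: "integrable unit_leb (\<lambda>x. \<bar>f x\<bar> powr p x)"
      and le: "(\<integral>x. \<bar>f x\<bar> powr p x \<partial>unit_leb) \<le> 1"
    have absf: "(\<lambda>x. \<bar>f x\<bar>) \<in> borel_measurable unit_leb" using f by measurable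
    have "integrable unit_leb (\<lambda>x. \<bar>f x\<bar>)"
      by (rule powr_integrable_imp_integrable[OF absf _ p1(3) int]) simp
    then have fi: "integrable unit_leb f" by (rule integrable_abs_cancel[OF _ f])
    define h where "h = walsh_partial_sum n f"
    define N where "N = n"
    have N: "n < 2 ^ N" "n \<le> 2 ^ N" unfolding N_def by (auto intro: less_imp_le)
    have hs: "dyadic_step N h" unfolding h_def by (rule walsh_partial_sum_step[OF N(2)])
    have hm: "h \<in> borel_measurable unit_leb" by (rule dyadic_step_measurable[OF hs])
    obtain B where B: "0 < B" "\<And>x. x \<in> {0..<1} \<Longrightarrow> \<bar>h x\<bar> \<le> B"
      using dyadic_step_bounded[OF hs] by blast
    define I where "I \<mu> = (\<integral>x. (\<bar>h x\<bar> / \<mu>) powr p x \<partial>unit_leb)" for \<mu>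
    have hint: "integrable unit_leb (\<lambda>x. (\<bar>h x\<bar> / \<mu>) powr p x)" if "0 < \<mu>" for \<mu>
    proof (rule integrable_powr_step[OF _ _ D(1) p1(2) D(3)])
      show "dyadic_step N (\<lambda>x. \<bar>h x\<bar> / \<mu>)"
        by (rule dyadic_step_map[where h = "\<lambda>u. \<bar>u\<bar> / \<mu>", OF hs])
    qed (use that in auto)
    have "I L \<le> 1"
    proof (rule ccontr)
      assume not: "\<not> I L \<le> 1"
      \<comment> \<open>Doubling the scale until the modular drops below one keeps it above \<open>2 powr (- b)\<close>, so that no
        continuity of the modular in the scale is needed.\<close>
      have "\<exists>j. I (2 ^ j * L) \<le> 1"
      proof -
        obtain j where j: "B < 2 ^ j" using real_arch_pow[of 2 B] by auto
        have "I (2 ^ j * L) \<le> (\<integral>x. 1 \<partial>unit_leb)"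
          unfolding I_def
        proof (rule integral_mono)
          show "integrable unit_leb (\<lambda>x. (\<bar>h x\<bar> / (2 ^ j * L)) powr p x)" using L1 by (intro hint) auto
          fix x assume "x \<in> space unit_leb"
          then have "\<bar>h x\<bar> \<le> 2 ^ j * 1" using B(2)[of x] j by simp
          also have "\<dots> \<le> 2 ^ j * L" using L1 by (intro mult_left_mono) auto
          finally show "(\<bar>h x\<bar> / (2 ^ j * L)) powr p x \<le> 1"
            using L1 p1(2)[of x] by (intro powr_le1) (auto simp: divide_le_eq)
        qed simp
        then show ?thesis by auto
      qed
      then obtain j where j: "I (2 ^ j * L) \<le> 1" "\<And>i. i < j \<Longrightarrow> \<not> I (2 ^ i * L) \<le> 1"
        unfolding exists_least_iff[of "\<lambda>j. I (2 ^ j * L) \<le> 1"] by blast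
      have "j \<noteq> 0" using j(1) not by (intro notI) simp
      then obtain i where i: "j = Suc i" by (cases j) auto
      define \<mu> where "\<mu> = 2 ^ j * L"
      have \<mu>: "0 < \<mu>" "L \<le> \<mu>" using L1 mult_right_mono[of 1 "2 ^ j" L] unfolding \<mu>_def by auto
      have I2: "1 < I (\<mu> / 2)" using j(2)[of i] unfolding \<mu>_def i by simp
      have "I (\<mu> / 2) \<le> (\<integral>x. 2 powr b * (\<bar>h x\<bar> / \<mu>) powr p x \<partial>unit_leb)"
        unfolding I_def
      proof (rule integral_mono)
        show "integrable unit_leb (\<lambda>x. (\<bar>h x\<bar> / (\<mu> / 2)) powr p x)" using \<mu> by (intro hint) auto
        show "integrable unit_leb (\<lambda>x. 2 powr b * (\<bar>h x\<bar> / \<mu>) powr p x)" using \<mu> by (intro integrable_mult_right hint) auto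
        fix x
        have "(\<bar>h x\<bar> / (\<mu> / 2)) powr p x = 2 powr p x * (\<bar>h x\<bar> / \<mu>) powr p x"
          by (simp add: powr_mult[symmetric] mult.commute)
        also have "\<dots> \<le> 2 powr b * (\<bar>h x\<bar> / \<mu>) powr p x"
          using D(3)[of x] by (intro mult_right_mono powr_mono) auto
        finally show "(\<bar>h x\<bar> / (\<mu> / 2)) powr p x \<le> 2 powr b * (\<bar>h x\<bar> / \<mu>) powr p x" .
      qed
      also have "\<dots> = 2 powr b * I \<mu>" unfolding I_def by simp
      finally have I3: "1 < 2 powr b * I \<mu>" using I2 by simp
      define g where "g x = sgn (h x) * (\<bar>h x\<bar> / \<mu>) powr (p x - 1)" for x
      have gm: "g \<in> borel_measurable unit_leb" unfolding g_def[abs_def] using hm D(1) by measurable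
      have absg: "\<bar>g x\<bar> powr ?q x = (\<bar>h x\<bar> / \<mu>) powr p x" for x
      proof (cases "h x = 0")
        case False
        then have "\<bar>g x\<bar> = (\<bar>h x\<bar> / \<mu>) powr (p x - 1)" unfolding g_def by (simp add: abs_mult abs_sgn_eq)
        then show ?thesis using p1(1)[of x] by (simp add: powr_powr)
      qed (simp add: g_def)
      have hg: "h x * g x = \<mu> * (\<bar>h x\<bar> / \<mu>) powr p x" for x
      proof -
        have "h x * g x = \<mu> * ((\<bar>h x\<bar> / \<mu>) * (\<bar>h x\<bar> / \<mu>) powr (p x - 1))"
          using \<mu> unfolding g_def by (simp add: abs_sgn mult.assoc)
        also have "(\<bar>h x\<bar> / \<mu>) * (\<bar>h x\<bar> / \<mu>) powr (p x - 1) = (\<bar>h x\<bar> / \<mu>) powr p x"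
          using \<mu> powr_mult_base[of "\<bar>h x\<bar> / \<mu>" "p x - 1"] by simp
        finally show ?thesis .
      qed
      have absgm: "(\<lambda>x. \<bar>g x\<bar>) \<in> borel_measurable unit_leb" using gm by measurable
      have gint: "integrable unit_leb (\<lambda>x. \<bar>g x\<bar> powr ?q x)" unfolding absg by (rule hint[OF \<mu>(1)])
      have gle: "(\<integral>x. \<bar>g x\<bar> powr ?q x \<partial>unit_leb) \<le> 1" unfolding absg using j(1) unfolding \<mu>_def I_def .
      have "integrable unit_leb (\<lambda>x. \<bar>g x\<bar>)"
        by (rule powr_integrable_imp_integrable[OF absgm _ _ gint]) (use p1 in \<open>auto simp: le_divide_eq\<close>)
      then have gi: "integrable unit_leb g" by (rule integrable_abs_cancel[OF _ gm])
      let ?M = "dyadic_max N (\<lambda>x. \<bar>f x\<bar>)" and ?M' = "dyadic_max N (\<lambda>x. \<bar>g x\<bar>)"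
      have M0: "0 \<le> ?M x" "0 \<le> ?M' x" for x by (rule dyadic_max_nonneg; simp)+
      have iM: "integrable unit_leb (\<lambda>x. ?M x powr p x)" "integrable unit_leb (\<lambda>x. ?M' x powr ?q x)"
        by (rule integrable_powr_step[OF dyadic_step_max M0(1) D(1) p1(2) D(3)],
            rule integrable_powr_step[OF dyadic_step_max M0(2) Dq(1) q0 Dq(3)])
      have "\<mu> * I \<mu> = (\<integral>x. h x * g x \<partial>unit_leb)" unfolding hg I_def by simp
      also have "\<dots> \<le> 3 * (\<integral>x. ?M x * ?M' x \<partial>unit_leb)"
        using walsh_pairing_bound[OF fi gi N(1)] unfolding h_def by linarith
      also have "(\<integral>x. ?M x * ?M' x \<partial>unit_leb) \<le> (\<integral>x. ?M x powr p x + ?M' x powr ?q x \<partial>unit_leb)"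
      proof (rule integral_mono)
        show "integrable unit_leb (\<lambda>x. ?M x * ?M' x)"
          by (intro dyadic_step_integrable[of N] dyadic_step_arith dyadic_step_max)
        show "integrable unit_leb (\<lambda>x. ?M x powr p x + ?M' x powr ?q x)"
          using iM by (rule Bochner_Integration.integrable_add)
        show "?M x * ?M' x \<le> ?M x powr p x + ?M' x powr ?q x" for x
          by (rule mult_le_powr_conjugate[OF M0 p1(1)])
      qed
      also have "\<dots> = (\<integral>x. ?M x powr p x \<partial>unit_leb) + (\<integral>x. ?M' x powr ?q x \<partial>unit_leb)"
        using iM by (rule Bochner_Integration.integral_add)
      also have "\<dots> \<le> C + C'"
        using C[OF absf _ int le, of N] C'[OF absgm _ gint gle, of N] by simp
      finally have "\<mu> * I \<mu> \<le> 3 * (C + C')" by simp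
      then have "\<mu> * (2 powr b * I \<mu>) \<le> 2 powr b * (3 * (C + C'))"
        using mult_left_mono[of "\<mu> * I \<mu>" "3 * (C + C')" "2 powr b"] by (simp add: mult.left_commute)
      also have "\<dots> \<le> L" unfolding L_def by simp
      also have "\<dots> \<le> \<mu> * 1" using \<mu> by simp
      also have "\<dots> < \<mu> * (2 powr b * I \<mu>)" using I3 \<mu> by (intro mult_strict_left_mono) auto
      finally show False by simp
    qed
    then show "(\<integral>x. (\<bar>walsh_partial_sum n f x\<bar> / L) powr p x \<partial>unit_leb) \<le> 1"
      unfolding I_def h_def .
  qed
qed

section \<open>Partial sums of dyadic step functions\<close>

lemma dyadic_avg_rademacher:
  assumes x: "x \<in> {0..<1}"
  shows "dyadic_avg n (rademacher n) x = 0"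
proof -
  have "rademacher n x = dyadic_avg (Suc n) (rademacher n) x"
    by (rule dyadic_avg_step[OF rademacher_step x, symmetric])
  also have "\<dots> = dyadic_avg n (rademacher n) x + rademacher n x * dyadic_avg n (\<lambda>y. rademacher n y * rademacher n y) x"
    by (rule dyadic_avg_split[OF dyadic_step_integrable[OF rademacher_step] x])
  also have "dyadic_avg n (\<lambda>y. rademacher n y * rademacher n y) x = 1"
    by (simp only: rademacher_sq dyadic_avg_const[OF x])
  finally show ?thesis by simp
qed

text \<open>Walsh functions of order at least \<open>2 ^ N\<close> are orthogonal to step functions of generation \<open>N\<close>,
since their leading Rademacher factor has average zero.\<close>

lemma walsh_coeff_step:
  assumes \<phi>: "dyadic_step N \<phi>" and k: "2 ^ N \<le> k"
  shows "walsh_coeff \<phi> k = 0"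
proof -
  define M where "M = floor_log k"
  have k0: "0 < k" using k by (rule less_le_trans[rotated]) simp
  have M: "2 ^ M \<le> k" "k < 2 ^ Suc M"
    unfolding M_def using floor_log_exp2_le[OF k0] floor_log_exp2_gt[of k] by auto
  have "(2::nat) ^ N < 2 ^ Suc M" using k M(2) by (rule le_less_trans)
  then have NM: "N \<le> M" by (simp add: power_strict_increasing_iff del: power_Suc)
  define j where "j = k - 2 ^ M"
  have j: "k = 2 ^ M + j" "j < 2 ^ M" using M unfolding j_def by auto
  have st: "dyadic_step M (\<lambda>x. \<phi> x * walsh j x)"
    by (intro dyadic_step_arith dyadic_step_mono[OF NM \<phi>] walsh_step j(2))
  have "walsh_coeff \<phi> k = (\<integral>x. rademacher M x * (\<phi> x * walsh j x) \<partial>unit_leb)"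
    unfolding walsh_coeff_def j(1) walsh_add_top[OF j(2)] by (simp only: mult.left_commute)
  also have "\<dots> = (\<integral>x. dyadic_avg M (rademacher M) x * (\<phi> x * walsh j x) \<partial>unit_leb)"
    by (rule integral_dyadic_avg[OF dyadic_step_integrable[OF rademacher_step] st, symmetric])
  also have "\<dots> = (\<integral>x. 0 \<partial>unit_leb)"
    by (intro Bochner_Integration.integral_cong refl) (simp only: space_unit_leb dyadic_avg_rademacher mult_zero_left)
  finally show ?thesis by simp
qed

lemma walsh_partial_sum_of_step:
  assumes \<phi>: "dyadic_step N \<phi>" and n: "2 ^ N \<le> n" and x: "x \<in> {0..<1}"
  shows "walsh_partial_sum n \<phi> x = \<phi> x"
proof -
  have "walsh_partial_sum n \<phi> x = walsh_partial_sum (2 ^ N) \<phi> x"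
    unfolding walsh_partial_sum_def
    by (rule sum.mono_neutral_right) (use n walsh_coeff_step[OF \<phi>] in auto)
  also have "\<dots> = \<phi> x"
    by (simp only: walsh_partial_sum_pow2[OF dyadic_step_integrable[OF \<phi>] x] dyadic_avg_step[OF \<phi> x])
  finally show ?thesis .
qed

lemma walsh_coeff_diff:
  assumes "integrable unit_leb f" "integrable unit_leb g"
  shows "walsh_coeff (\<lambda>x. f x - g x) n = walsh_coeff f n - walsh_coeff g n"
proof -
  have "n < 2 ^ n" by simp
  from walsh_step[OF this] show ?thesis
    unfolding walsh_coeff_def left_diff_distrib
    by (intro Bochner_Integration.integral_diff dyadic_step_integrable_mult assms)
qed

lemma walsh_partial_sum_diff:
  assumes "integrable unit_leb f" "integrable unit_leb g"
  shows "walsh_partial_sum n (\<lambda>x. f x - g x) x = walsh_partial_sum n f x - walsh_partial_sum n g x"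
  unfolding walsh_partial_sum_def walsh_coeff_diff[OF assms] by (simp add: left_diff_distrib sum_subtractf)

lemma walsh_partial_sum_divide:
  "walsh_partial_sum n (\<lambda>x. f x / c) x = walsh_partial_sum n f x / c"
  unfolding walsh_partial_sum_def walsh_coeff_def by (simp add: sum_divide_distrib)

section \<open>Density of dyadic step functions\<close>

text \<open>A triangle inequality for modulars: the factor \<open>4\<close> provides the convex combination on the right,
so that two modulars bounded by one give a modular bounded by one.\<close>

lemma powr_sum_quarter:
  fixes u v c p :: real
  assumes "0 \<le> u" "0 \<le> v" "0 < c" "1 \<le> p"
  shows "((u + v) / (4 * c)) powr p \<le> ((u / c) powr p + (v / c) powr p) / 2"
proof -
  have half: "(w / (2 * c)) powr p \<le> (w / c) powr p / 2" if "0 \<le> w" for w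
  proof -
    have "(w / (2 * c)) powr p = (1 / 2) powr p * (w / c) powr p"
      by (simp add: powr_mult[symmetric])
    also have "(1 / 2 :: real) powr p \<le> (1 / 2) powr 1"
      using assms by (intro powr_mono') auto
    finally show ?thesis by (simp add: mult_right_mono)
  qed
  have "((u + v) / (4 * c)) powr p \<le> (max u v / (2 * c)) powr p"
    using assms by (intro powr_mono2) (auto simp: field_simps max_def)
  also have "\<dots> \<le> (u / (2 * c)) powr p + (v / (2 * c)) powr p"
    by (auto simp: max_def)
  also have "\<dots> \<le> ((u / c) powr p + (v / c) powr p) / 2"
    using half[of u] half[of v] assms by simp
  finally show ?thesis .
qed

text \<open>\<open>f\<close> lies in the closure of the dyadic step functions for the Luxemburg norm, expressed by
modulars: \<open>\<parallel>f - \<phi>\<parallel> \<le> c\<close> as soon as the modular of \<open>(f - \<phi>) / c\<close> is at most one.\<close>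

definition dyadic_approximable :: "(real \<Rightarrow> real) \<Rightarrow> (real \<Rightarrow> real) \<Rightarrow> bool" where
  "dyadic_approximable p f \<longleftrightarrow>
     (\<forall>c>0. \<exists>N \<phi>. dyadic_step N \<phi> \<and> integrable unit_leb (\<lambda>x. (\<bar>f x - \<phi> x\<bar> / c) powr p x) \<and>
        (\<integral>x. (\<bar>f x - \<phi> x\<bar> / c) powr p x \<partial>unit_leb) \<le> 1)"

lemma dyadic_approximable_step: "dyadic_step n \<phi> \<Longrightarrow> dyadic_approximable p \<phi>"
  unfolding dyadic_approximable_def by (intro allI impI exI[of _ n] exI[of _ \<phi>]) simp

text \<open>Approximability passes to dominated almost everywhere limits. It is applied in turn to the
passages from step functions to bounded continuous functions, from these to bounded measurable
functions, and from these to all functions of finite modular.\<close>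

lemma dyadic_approximable_limit:
  assumes p: "p \<in> borel_measurable unit_leb" "\<And>x. 1 \<le> p x" "\<And>x. p x \<le> b"
    and F: "\<And>n. F n \<in> borel_measurable unit_leb" "\<And>n. dyadic_approximable p (F n)"
    and f: "f \<in> borel_measurable unit_leb"
    and lim: "AE x in unit_leb. (\<lambda>n. F n x) \<longlonglongrightarrow> f x"
    and bd: "\<And>n x. x \<in> {0..<1} \<Longrightarrow> \<bar>F n x\<bar> \<le> H x" "\<And>x. x \<in> {0..<1} \<Longrightarrow> \<bar>f x\<bar> \<le> H x"
    and H: "integrable unit_leb (\<lambda>x. H x powr p x)"
  shows "dyadic_approximable p f"
  unfolding dyadic_approximable_def
proof (intro allI impI)
  fix c :: real assume c: "0 < c"
  define d where "d = c / 4"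
  have d: "0 < d" "c = 4 * d" unfolding d_def using c by auto
  let ?E = "\<lambda>n x. (\<bar>f x - F n x\<bar> / d) powr p x"
  have Em: "?E n \<in> borel_measurable unit_leb" for n using f F(1) p(1) by measurable
  have dom: "?E n x \<le> (1 + 2 / d) powr b * H x powr p x" if x: "x \<in> {0..<1}" for n x
  proof -
    have "\<bar>f x - F n x\<bar> \<le> 2 * H x" using bd(1)[OF x, of n] bd(2)[OF x] by linarith
    then have "\<bar>f x - F n x\<bar> / d \<le> 2 / d * H x" using d by (simp add: divide_right_mono)
    also have "\<dots> \<le> (1 + 2 / d) * H x" using d bd(2)[OF x] by (intro mult_right_mono) auto
    finally have "?E n x \<le> ((1 + 2 / d) * H x) powr p x"
      using p(2)[of x] d by (intro powr_mono2) auto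
    also have "\<dots> = (1 + 2 / d) powr p x * H x powr p x" by (simp add: powr_mult)
    also have "\<dots> \<le> (1 + 2 / d) powr b * H x powr p x"
      using p(3)[of x] d by (intro mult_right_mono powr_mono) auto
    finally show ?thesis .
  qed
  have dom_int: "integrable unit_leb (\<lambda>x. (1 + 2 / d) powr b * H x powr p x)"
    using H by (intro integrable_mult_right)
  have Eint: "integrable unit_leb (?E n)" for n
    by (rule Bochner_Integration.integrable_bound[OF dom_int Em]) (use dom[of _ n] in \<open>auto intro!: AE_I2 order_trans[OF _ abs_ge_self]\<close>)
  have "(\<lambda>n. \<integral>x. ?E n x \<partial>unit_leb) \<longlonglongrightarrow> (\<integral>x. 0 \<partial>unit_leb)"
  proof (rule integral_dominated_convergence[OF _ Em dom_int])
    show "AE x in unit_leb. (\<lambda>n. ?E n x) \<longlonglongrightarrow> 0"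
      using lim
    proof eventually_elim
      fix x assume "(\<lambda>n. F n x) \<longlonglongrightarrow> f x"
      then have "(\<lambda>n. \<bar>f x - F n x\<bar> / d) \<longlonglongrightarrow> \<bar>f x - f x\<bar> / d"
        using d by (intro tendsto_intros) auto
      then have "(\<lambda>n. \<bar>f x - F n x\<bar> / d) \<longlonglongrightarrow> 0" by simp
      then show "(\<lambda>n. ?E n x) \<longlonglongrightarrow> 0"
        by (rule tendsto_zero_powrI[OF _ tendsto_const])
           (use d(1) p(2)[of x] in \<open>auto intro: less_le_trans[OF zero_less_one]\<close>)
    qed
    show "AE x in unit_leb. norm (?E n x) \<le> (1 + 2 / d) powr b * H x powr p x" for n
      by (rule AE_I2) (use dom[of _ n] in auto)
  qed simp
  then have "\<forall>\<^sub>F n in sequentially. (\<integral>x. ?E n x \<partial>unit_leb) < 1"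
    by (intro order_tendstoD(2)) auto
  then obtain n where n: "(\<integral>x. ?E n x \<partial>unit_leb) < 1"
    by (auto simp: eventually_sequentially)
  obtain N \<phi> where \<phi>: "dyadic_step N \<phi>" "integrable unit_leb (\<lambda>x. (\<bar>F n x - \<phi> x\<bar> / d) powr p x)"
    "(\<integral>x. (\<bar>F n x - \<phi> x\<bar> / d) powr p x \<partial>unit_leb) \<le> 1"
    using F(2)[of n] d(1) unfolding dyadic_approximable_def by blast
  let ?S = "\<lambda>x. (?E n x + (\<bar>F n x - \<phi> x\<bar> / d) powr p x) / 2"
  have Sint: "integrable unit_leb ?S"
    by (intro integrable_divide Bochner_Integration.integrable_add Eint \<phi>)
  have le: "(\<bar>f x - \<phi> x\<bar> / c) powr p x \<le> ?S x" for x
  proof -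
    have "(\<bar>f x - \<phi> x\<bar> / c) powr p x \<le> ((\<bar>f x - F n x\<bar> + \<bar>F n x - \<phi> x\<bar>) / (4 * d)) powr p x"
      unfolding d(2) using d(1) p(2)[of x] by (intro powr_mono2 divide_right_mono) auto
    also have "\<dots> \<le> ?S x" using d(1) p(2)[of x] by (intro powr_sum_quarter) auto
    finally show ?thesis .
  qed
  have int: "integrable unit_leb (\<lambda>x. (\<bar>f x - \<phi> x\<bar> / c) powr p x)"
  proof (rule Bochner_Integration.integrable_bound[OF Sint])
    show "(\<lambda>x. (\<bar>f x - \<phi> x\<bar> / c) powr p x) \<in> borel_measurable unit_leb"
      using f dyadic_step_measurable[OF \<phi>(1)] p(1) by measurable
    show "AE x in unit_leb. norm ((\<bar>f x - \<phi> x\<bar> / c) powr p x) \<le> norm (?S x)"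
      by (rule AE_I2) (use le in \<open>auto intro!: order_trans[OF _ abs_ge_self]\<close>)
  qed
  have "(\<integral>x. (\<bar>f x - \<phi> x\<bar> / c) powr p x \<partial>unit_leb) \<le> (\<integral>x. ?S x \<partial>unit_leb)"
    by (rule integral_mono[OF int Sint le])
  also have "\<dots> = ((\<integral>x. ?E n x \<partial>unit_leb) + (\<integral>x. (\<bar>F n x - \<phi> x\<bar> / d) powr p x \<partial>unit_leb)) / 2"
    by (simp only: integral_divide_zero Bochner_Integration.integral_add[OF Eint \<phi>(2)])
  also have "\<dots> \<le> 1" using n \<phi>(3) by simp
  finally show "\<exists>N \<phi>. dyadic_step N \<phi> \<and> integrable unit_leb (\<lambda>x. (\<bar>f x - \<phi> x\<bar> / c) powr p x) \<and>
        (\<integral>x. (\<bar>f x - \<phi> x\<bar> / c) powr p x \<partial>unit_leb) \<le> 1"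
    using \<phi>(1) int by blast
qed

lemma dyadic_approximable_continuous:
  assumes p: "p \<in> borel_measurable unit_leb" "\<And>x. 1 \<le> p x" "\<And>x. p x \<le> b"
    and g: "continuous_on UNIV g" "\<And>x. \<bar>g x\<bar> \<le> B"
  shows "dyadic_approximable p g"
proof (rule dyadic_approximable_limit[OF p, of "\<lambda>n x. g (real_of_int \<lfloor>2 ^ n * x\<rfloor> / 2 ^ n)" g "\<lambda>_. B"])
  have st: "dyadic_step n (\<lambda>x. g (real_of_int \<lfloor>2 ^ n * x\<rfloor> / 2 ^ n))" for n
    unfolding dyadic_step_def by simp
  show "(\<lambda>x. g (real_of_int \<lfloor>2 ^ n * x\<rfloor> / 2 ^ n)) \<in> borel_measurable unit_leb"
    "dyadic_approximable p (\<lambda>x. g (real_of_int \<lfloor>2 ^ n * x\<rfloor> / 2 ^ n))" for n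
    using dyadic_step_measurable[OF st] dyadic_approximable_step[OF st] by auto
  show "g \<in> borel_measurable unit_leb"
    by (rule measurable_unit_leb_of_borel[OF borel_measurable_continuous_onI[OF g(1)]])
  have B: "0 \<le> B" using g(2)[of 0] by linarith
  have p0: "0 \<le> p x" for x using p(2)[of x] by linarith
  show "integrable unit_leb (\<lambda>x. B powr p x)"
    by (rule integrable_powr_bounded[of _ B p b]) (use p p0 B in auto)
  show "AE x in unit_leb. (\<lambda>n. g (real_of_int \<lfloor>2 ^ n * x\<rfloor> / 2 ^ n)) \<longlonglongrightarrow> g x"
  proof (rule AE_I2)
    fix x :: real
    have "(\<lambda>n. real_of_int \<lfloor>2 ^ n * x\<rfloor> / 2 ^ n) \<longlonglongrightarrow> x"
    proof (rule real_tendsto_sandwich)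
      show "\<forall>\<^sub>F n in sequentially. x - (1 / 2) ^ n \<le> real_of_int \<lfloor>2 ^ n * x\<rfloor> / 2 ^ n"
      proof (rule always_eventually, rule allI)
        fix n
        have "2 ^ n * x - 1 \<le> real_of_int \<lfloor>2 ^ n * x\<rfloor>" by linarith
        then have "(2 ^ n * x - 1) / 2 ^ n \<le> real_of_int \<lfloor>2 ^ n * x\<rfloor> / 2 ^ n"
          by (rule divide_right_mono) simp
        then show "x - (1 / 2) ^ n \<le> real_of_int \<lfloor>2 ^ n * x\<rfloor> / 2 ^ n"
          by (simp add: diff_divide_distrib power_one_over)
      qed
      show "\<forall>\<^sub>F n in sequentially. real_of_int \<lfloor>2 ^ n * x\<rfloor> / 2 ^ n \<le> x"
      proof (rule always_eventually, rule allI)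
        fix n
        have "real_of_int \<lfloor>2 ^ n * x\<rfloor> / 2 ^ n \<le> (2 ^ n * x) / 2 ^ n"
          by (intro divide_right_mono of_int_floor_le) simp
        then show "real_of_int \<lfloor>2 ^ n * x\<rfloor> / 2 ^ n \<le> x" by simp
      qed
      have "(\<lambda>n. x - (1 / 2) ^ n) \<longlonglongrightarrow> x - 0"
        by (intro tendsto_intros LIMSEQ_power_zero) simp
      then show "(\<lambda>n. x - (1 / 2) ^ n) \<longlonglongrightarrow> x" by simp
    qed simp
    then show "(\<lambda>n. g (real_of_int \<lfloor>2 ^ n * x\<rfloor> / 2 ^ n)) \<longlonglongrightarrow> g x"
      by (rule continuous_on_tendsto_compose[OF g(1)]) auto
  qed
qed (use g(2) in auto)

lemma dyadic_approximable_bounded: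
  assumes p: "p \<in> borel_measurable unit_leb" "\<And>x. 1 \<le> p x" "\<And>x. p x \<le> b"
    and f: "f \<in> borel_measurable unit_leb" "\<And>x. x \<in> {0..<1} \<Longrightarrow> \<bar>f x\<bar> \<le> B"
  shows "dyadic_approximable p f"
proof -
  have B: "0 \<le> B" using f(2)[of 0] by auto
  have p0: "0 \<le> p x" for x using p(2)[of x] by linarith
  have "f measurable_on {0..<1}"
    using f(1) by (subst measurable_on_iff_borel_measurable) auto
  then obtain N g where N: "negligible N" and g: "\<And>n::nat. continuous_on UNIV (g n :: real \<Rightarrow> real)"
    "\<And>x. x \<notin> N \<Longrightarrow> (\<lambda>n. g n x) \<longlonglongrightarrow> (if x \<in> {0..<1} then f x else 0)"
    unfolding measurable_on_def by blast
  define G where "G n x = max (- B) (min B (g n x))" for n x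
  have Gc: "continuous_on UNIV (G n)" for n
    unfolding G_def[abs_def] by (intro continuous_intros g)
  have Gb: "\<bar>G n x\<bar> \<le> B" for n x unfolding G_def using B by auto
  show ?thesis
  proof (rule dyadic_approximable_limit[OF p, of G f "\<lambda>_. B"])
    show "G n \<in> borel_measurable unit_leb" for n
      by (rule measurable_unit_leb_of_borel[OF borel_measurable_continuous_onI[OF Gc]])
    show "dyadic_approximable p (G n)" for n
      by (rule dyadic_approximable_continuous[OF p Gc Gb])
    show "integrable unit_leb (\<lambda>x. B powr p x)"
      by (rule integrable_powr_bounded[of _ B p b]) (use p p0 B in auto)
    have "AE x in lebesgue. x \<notin> N"
      using N by (intro AE_not_in) (simp add: negligible_iff_null_sets)
    then have "AE x in unit_leb. x \<notin> N"
      by (subst AE_restrict_space_iff) (auto elim: eventually_mono)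
    moreover have "AE x in unit_leb. x \<in> {0..<1}" by (rule AE_I2) simp
    ultimately show "AE x in unit_leb. (\<lambda>n. G n x) \<longlonglongrightarrow> f x"
    proof eventually_elim
      fix x :: real assume x: "x \<notin> N" "x \<in> {0..<1}"
      then have "(\<lambda>n. g n x) \<longlonglongrightarrow> f x" using g(2)[of x] by simp
      then have "(\<lambda>n. G n x) \<longlonglongrightarrow> max (- B) (min B (f x))"
        unfolding G_def by (intro tendsto_intros)
      also have "max (- B) (min B (f x)) = f x" using f(2)[OF x(2)] by auto
      finally show "(\<lambda>n. G n x) \<longlonglongrightarrow> f x" .
    qed
  qed (use Gb f in auto)
qed

lemma dyadic_approximable_modular:
  assumes p: "p \<in> borel_measurable unit_leb" "\<And>x. 1 \<le> p x" "\<And>x. p x \<le> b"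
    and f: "f \<in> borel_measurable unit_leb" "integrable unit_leb (\<lambda>x. \<bar>f x\<bar> powr p x)"
  shows "dyadic_approximable p f"
proof -
  define F where "F n x = max (- real n) (min (real n) (f x))" for n x
  have Fm: "F n \<in> borel_measurable unit_leb" for n
    unfolding F_def[abs_def] using f(1) by measurable
  show ?thesis
  proof (rule dyadic_approximable_limit[OF p Fm _ f(1) _ _ _ f(2)])
    show "dyadic_approximable p (F n)" for n
      by (rule dyadic_approximable_bounded[OF p Fm, of _ "real n"]) (auto simp: F_def)
    show "AE x in unit_leb. (\<lambda>n. F n x) \<longlonglongrightarrow> f x"
    proof (rule AE_I2)
      fix x
      have "\<forall>\<^sub>F n in sequentially. F n x = f x"
        using eventually_ge_at_top[of "nat \<lceil>\<bar>f x\<bar>\<rceil>"]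
      proof eventually_elim
        case (elim n)
        then have "\<bar>f x\<bar> \<le> real n" by linarith
        then show ?case unfolding F_def by auto
      qed
      then show "(\<lambda>n. F n x) \<longlonglongrightarrow> f x" by (rule tendsto_eventually)
    qed
    show "\<bar>F n x\<bar> \<le> \<bar>f x\<bar>" for n x unfolding F_def by auto
  qed auto
qed

section \<open>Convergence\<close>

text \<open>Convergence in modular at every scale \<open>\<epsilon>\<close>: with a step function \<open>\<phi>\<close> close to \<open>f\<close>,
\<open>s\<^sub>n f - f = s\<^sub>n (f - \<phi>) - (f - \<phi>)\<close> for large \<open>n\<close>.\<close>

lemma walsh_partial_sum_modular_tendsto:
  assumes p: "dyadic_log_Hoelder a b p K" and a: "1 < a"
    and f: "f \<in> borel_measurable unit_leb" "integrable unit_leb (\<lambda>x. \<bar>f x\<bar> powr p x)"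
    and \<epsilon>: "0 < \<epsilon>"
  shows "\<forall>\<^sub>F n in sequentially. integrable unit_leb (\<lambda>x. (\<bar>walsh_partial_sum n f x - f x\<bar> / \<epsilon>) powr p x) \<and>
     (\<integral>x. (\<bar>walsh_partial_sum n f x - f x\<bar> / \<epsilon>) powr p x \<partial>unit_leb) \<le> 1"
proof -
  note D = dyadic_log_HoelderD[OF p]
  have p1: "1 \<le> p x" "0 \<le> p x" for x using D(2)[of x] a by auto
  obtain L where L: "1 \<le> L" "\<And>f n. f \<in> borel_measurable unit_leb \<Longrightarrow>
    integrable unit_leb (\<lambda>x. \<bar>f x\<bar> powr p x) \<Longrightarrow> (\<integral>x. \<bar>f x\<bar> powr p x \<partial>unit_leb) \<le> 1 \<Longrightarrow>
    (\<integral>x. (\<bar>walsh_partial_sum n f x\<bar> / L) powr p x \<partial>unit_leb) \<le> 1"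
    using walsh_partial_sum_bounded[OF p a] by blast
  define c where "c = \<epsilon> / (4 * L)"
  have c: "0 < c" "\<epsilon> = 4 * (c * L)" unfolding c_def using \<epsilon> L(1) by auto
  have cL: "0 < c * L" "c \<le> c * L" using c(1) L(1) by auto
  obtain N \<phi> where \<phi>: "dyadic_step N \<phi>" "integrable unit_leb (\<lambda>x. (\<bar>f x - \<phi> x\<bar> / c) powr p x)"
    "(\<integral>x. (\<bar>f x - \<phi> x\<bar> / c) powr p x \<partial>unit_leb) \<le> 1"
    using dyadic_approximable_modular[OF D(1) p1(1) D(3) f] c(1) unfolding dyadic_approximable_def by blast
  have absf: "(\<lambda>x. \<bar>f x\<bar>) \<in> borel_measurable unit_leb" using f(1) by measurable
  have "integrable unit_leb (\<lambda>x. \<bar>f x\<bar>)"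
    by (rule powr_integrable_imp_integrable[OF absf _ p1(1) f(2)]) simp
  then have fi: "integrable unit_leb f" by (rule integrable_abs_cancel[OF _ f(1)])
  define d where "d x = f x - \<phi> x" for x
  have dm: "d \<in> borel_measurable unit_leb"
    unfolding d_def[abs_def] using f(1) dyadic_step_measurable[OF \<phi>(1)] by measurable
  have dcm: "(\<lambda>x. d x / c) \<in> borel_measurable unit_leb" using dm by measurable
  have absc: "\<bar>u / c\<bar> = \<bar>u\<bar> / c" for u using c(1) by simp
  have di: "integrable unit_leb (\<lambda>x. \<bar>d x / c\<bar> powr p x)" "(\<integral>x. \<bar>d x / c\<bar> powr p x \<partial>unit_leb) \<le> 1"
    using \<phi>(2,3) unfolding absc d_def by auto
  have main: "integrable unit_leb (\<lambda>x. (\<bar>walsh_partial_sum n f x - f x\<bar> / \<epsilon>) powr p x) \<and>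
     (\<integral>x. (\<bar>walsh_partial_sum n f x - f x\<bar> / \<epsilon>) powr p x \<partial>unit_leb) \<le> 1" if n: "2 ^ N \<le> n" for n
  proof -
    have eq: "walsh_partial_sum n f x - f x = walsh_partial_sum n d x - d x" if "x \<in> {0..<1}" for x
      using walsh_partial_sum_diff[OF fi dyadic_step_integrable[OF \<phi>(1)], of n x]
        walsh_partial_sum_of_step[OF \<phi>(1) n that] unfolding d_def by simp
    let ?s = "walsh_partial_sum n d"
    have ss: "dyadic_step n ?s" by (rule walsh_partial_sum_step) (auto intro: less_imp_le)
    have "dyadic_step n (\<lambda>x. \<bar>?s x\<bar> / (c * L))"
      by (rule dyadic_step_map[where h = "\<lambda>u. \<bar>u\<bar> / (c * L)", OF ss])
    then have i1: "integrable unit_leb (\<lambda>x. (\<bar>?s x\<bar> / (c * L)) powr p x)"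
      by (rule integrable_powr_step[OF _ _ D(1) p1(2) D(3)]) (use cL in auto)
    have "\<bar>walsh_partial_sum n (\<lambda>x. d x / c) x\<bar> / L = \<bar>?s x\<bar> / (c * L)" for x
      unfolding walsh_partial_sum_divide absc by simp
    then have l1: "(\<integral>x. (\<bar>?s x\<bar> / (c * L)) powr p x \<partial>unit_leb) \<le> 1"
      using L(2)[OF dcm di, of n] by (simp only:)
    have le2: "(\<bar>d x\<bar> / (c * L)) powr p x \<le> \<bar>d x / c\<bar> powr p x" for x
      unfolding absc using c(1) cL p1(2)[of x] by (intro powr_mono2 divide_left_mono) auto
    have i2: "integrable unit_leb (\<lambda>x. (\<bar>d x\<bar> / (c * L)) powr p x)"
    proof (rule Bochner_Integration.integrable_bound[OF di(1)])
      show "(\<lambda>x. (\<bar>d x\<bar> / (c * L)) powr p x) \<in> borel_measurable unit_leb" using dm D(1) by measurable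
      show "AE x in unit_leb. norm ((\<bar>d x\<bar> / (c * L)) powr p x) \<le> norm (\<bar>d x / c\<bar> powr p x)"
        by (rule AE_I2) (use le2 in simp)
    qed
    have l2: "(\<integral>x. (\<bar>d x\<bar> / (c * L)) powr p x \<partial>unit_leb) \<le> 1"
      using integral_mono[OF i2 di(1) le2] di(2) by linarith
    let ?S = "\<lambda>x. ((\<bar>?s x\<bar> / (c * L)) powr p x + (\<bar>d x\<bar> / (c * L)) powr p x) / 2"
    have Si: "integrable unit_leb ?S"
      by (intro integrable_divide Bochner_Integration.integrable_add i1 i2)
    have le: "(\<bar>walsh_partial_sum n f x - f x\<bar> / \<epsilon>) powr p x \<le> ?S x" if x: "x \<in> {0..<1}" for x
    proof -
      have "(\<bar>walsh_partial_sum n f x - f x\<bar> / \<epsilon>) powr p x \<le> ((\<bar>?s x\<bar> + \<bar>d x\<bar>) / (4 * (c * L))) powr p x"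
        unfolding eq[OF x] c(2) using cL(1) p1(2)[of x] by (intro powr_mono2 divide_right_mono) auto
      also have "\<dots> \<le> ?S x" using cL(1) p1(1)[of x] by (intro powr_sum_quarter) auto
      finally show ?thesis .
    qed
    have int: "integrable unit_leb (\<lambda>x. (\<bar>walsh_partial_sum n f x - f x\<bar> / \<epsilon>) powr p x)"
    proof (rule Bochner_Integration.integrable_bound[OF Si])
      have "walsh_partial_sum n f \<in> borel_measurable unit_leb"
        by (rule dyadic_step_measurable[OF walsh_partial_sum_step[of n n]]) (auto intro: less_imp_le)
      then show "(\<lambda>x. (\<bar>walsh_partial_sum n f x - f x\<bar> / \<epsilon>) powr p x) \<in> borel_measurable unit_leb"
        using f(1) D(1) by measurable
      show "AE x in unit_leb. norm ((\<bar>walsh_partial_sum n f x - f x\<bar> / \<epsilon>) powr p x) \<le> norm (?S x)"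
        by (rule AE_I2) (use le in \<open>auto intro!: order_trans[OF _ abs_ge_self]\<close>)
    qed
    have "(\<integral>x. (\<bar>walsh_partial_sum n f x - f x\<bar> / \<epsilon>) powr p x \<partial>unit_leb) \<le> (\<integral>x. ?S x \<partial>unit_leb)"
      by (rule integral_mono[OF int Si]) (use le in auto)
    also have "\<dots> = ((\<integral>x. (\<bar>?s x\<bar> / (c * L)) powr p x \<partial>unit_leb) + (\<integral>x. (\<bar>d x\<bar> / (c * L)) powr p x \<partial>unit_leb)) / 2"
      by (simp only: integral_divide_zero Bochner_Integration.integral_add[OF i1 i2])
    also have "\<dots> \<le> 1" using l1 l2 by simp
    finally show ?thesis using int by blast
  qed
  show ?thesis
    using eventually_ge_at_top[of "2 ^ N"] by (rule eventually_mono) (rule main)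
qed

lemma AE_essinf_le:
  fixes f :: "'a \<Rightarrow> ereal"
  assumes f: "f \<in> borel_measurable M"
  shows "AE x in M. essinf M f \<le> f x"
proof -
  have "esssup M (\<lambda>x. - f x) = - essinf M f"
    unfolding esssup_def essinf_def using f by (simp add: ereal_Limsup_uminus)
  then show ?thesis
    using esssup_AE[where M = M and f = "\<lambda>x. - f x"] by simp
qed

lemma AE_p_minus_p_plus:
  assumes p: "p \<in> borel_measurable unit_leb" and A: "A \<in> sets unit_leb"
  shows "AE x in lebesgue_on A. p_minus p A \<le> ereal (p x) \<and> ereal (p x) \<le> p_plus p A"
proof -
  have "A \<subseteq> {0..<1}" using sets.sets_into_space[OF A] by simp
  then have "p \<in> borel_measurable (lebesgue_on A)"
    using p by (rule measurable_restrict_mono[rotated])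
  then have "(\<lambda>x. ereal (p x)) \<in> borel_measurable (lebesgue_on A)" by measurable
  from AE_essinf_le[OF this] esssup_AE show ?thesis
    unfolding p_minus_def p_plus_def by eventually_elim auto
qed

text \<open>The exponent is clipped to \<open>[a, b]\<close>, which changes it on a null set only.\<close>

lemma dyadic_log_Hoelder_of_p_minus_p_plus:
  assumes p: "p \<in> borel_measurable unit_leb"
    and ab: "p_minus p {0..<1} = ereal a" "p_plus p {0..<1} = ereal b"
    and LH: "\<And>A. A \<in> dyadic_intervals \<Longrightarrow>
           measure lebesgue A powr real_of_ereal (p_minus p A - p_plus p A) \<le> K"
  shows "dyadic_log_Hoelder a b (\<lambda>x. max a (min b (p x))) K" "AE x in unit_leb. a \<le> p x \<and> p x \<le> b"
proof -
  show AE: "AE x in unit_leb. a \<le> p x \<and> p x \<le> b"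
    using AE_p_minus_p_plus[OF p, of "{0..<1}"] unfolding ab by simp
  have pos: "\<exists>x. P x" if "AE x in unit_leb. x \<in> dyadic_cell n k \<longrightarrow> P x" "k \<in> {0..<2 ^ n}" for P n k
  proof (rule ccontr)
    assume "\<nexists>x. P x"
    with that(1) have "AE x in unit_leb. x \<notin> dyadic_cell n k" by simp
    then have "dyadic_cell n k \<in> null_sets unit_leb"
      by (subst (asm) AE_iff_null_sets[symmetric]) auto
    then show False using dyadic_cell_measure[OF that(2)] by (simp add: measure_eq_0_null_sets)
  qed
  have le: "a \<le> b"
  proof -
    have "AE x in unit_leb. x \<in> dyadic_cell 0 0 \<longrightarrow> a \<le> p x \<and> p x \<le> b"
      using AE by (rule eventually_mono) simp
    from pos[OF this] show ?thesis by auto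
  qed
  show "dyadic_log_Hoelder a b (\<lambda>x. max a (min b (p x))) K"
    unfolding dyadic_log_Hoelder_def
  proof (intro conjI allI ballI)
    show "(\<lambda>x. max a (min b (p x))) \<in> borel_measurable unit_leb" using p by measurable
    show "a \<le> max a (min b (p x))" "max a (min b (p x)) \<le> b" for x using le by auto
    fix n :: nat and k :: int assume k: "k \<in> {0..<2 ^ n}"
    define A where "A = dyadic_cell n k"
    have A: "A \<in> sets unit_leb" unfolding A_def by (rule dyadic_cell_measurable)
    have Asub: "A \<subseteq> {0..<1}" unfolding A_def dyadic_cell_def by auto
    have Aleb: "A \<in> sets lebesgue" using A by (simp add: sets_restrict_space_iff)
    have transfer: "(AE x in lebesgue_on A. P x) \<longleftrightarrow> (AE x in unit_leb. x \<in> A \<longrightarrow> P x)" for P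
    proof -
      have "(AE x in lebesgue_on A. P x) \<longleftrightarrow> (AE x in lebesgue. x \<in> A \<longrightarrow> P x)"
        using Aleb by (subst AE_restrict_space_iff) auto
      also have "(\<lambda>x. x \<in> A \<longrightarrow> P x) = (\<lambda>x. x \<in> {0..<1} \<longrightarrow> x \<in> A \<longrightarrow> P x)"
        using Asub by blast
      also have "(AE x in lebesgue. x \<in> {0..<1} \<longrightarrow> x \<in> A \<longrightarrow> P x) \<longleftrightarrow> (AE x in unit_leb. x \<in> A \<longrightarrow> P x)"
        by (subst AE_restrict_space_iff) auto
      finally show ?thesis .
    qed
    have AEA: "AE x in lebesgue_on A. p_minus p A \<le> ereal (p x) \<and> ereal (p x) \<le> p_plus p A"
      by (rule AE_p_minus_p_plus[OF p A])
    have AEab: "AE x in lebesgue_on A. a \<le> p x \<and> p x \<le> b"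
      unfolding transfer using AE by (rule eventually_mono) simp
    have pm: "(\<lambda>x. ereal (p x)) \<in> borel_measurable (lebesgue_on A)"
      using measurable_restrict_mono[OF p Asub] by measurable
    have lo: "ereal a \<le> p_minus p A"
      unfolding p_minus_def essinf_def using AEab by (intro Liminf_bounded) (auto elim: eventually_mono)
    have hi: "p_plus p A \<le> ereal b"
      unfolding p_plus_def using AEab by (intro esssup_I pm) (auto elim: eventually_mono)
    obtain x0 where "p_minus p A \<le> ereal (p x0)" "ereal (p x0) \<le> p_plus p A"
    proof -
      have "AE x in unit_leb. x \<in> dyadic_cell n k \<longrightarrow> p_minus p A \<le> ereal (p x) \<and> ereal (p x) \<le> p_plus p A"
        using AEA unfolding transfer by (simp only: A_def)
      from pos[OF this k] show ?thesis using that by (elim exE conjE)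
    qed
    with lo hi obtain \<alpha> \<beta> where \<alpha>\<beta>: "p_minus p A = ereal \<alpha>" "p_plus p A = ereal \<beta>" "a \<le> \<alpha>" "\<alpha> \<le> \<beta>" "\<beta> \<le> b"
      by (cases "p_minus p A"; cases "p_plus p A") auto
    have "A \<in> dyadic_intervals"
    proof -
      have "A = {real (nat k) / 2 ^ n ..< (real (nat k) + 1) / 2 ^ n}"
        unfolding A_def using k by (subst dyadic_cell_eq) auto
      moreover have "nat k < 2 ^ n" using k by (simp add: nat_less_iff)
      ultimately show ?thesis unfolding dyadic_intervals_def by blast
    qed
    from LH[OF this] have "measure lebesgue A powr (\<alpha> - \<beta>) \<le> K" unfolding \<alpha>\<beta> by simp
    moreover have "measure lebesgue A = 1 / 2 ^ n"
      using dyadic_cell_measure[OF k] Asub unfolding A_def by (subst (asm) measure_restrict_space) auto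
    moreover have "(1 / 2 ^ n) powr (\<alpha> - \<beta>) = (2 ^ n :: real) powr (\<beta> - \<alpha>)"
      by (simp add: powr_divide powr_diff)
    ultimately have "(2 ^ n) powr (\<beta> - \<alpha>) \<le> K" by simp
    moreover have "AE x in unit_leb. x \<in> dyadic_cell n k \<longrightarrow> \<alpha> \<le> max a (min b (p x)) \<and> max a (min b (p x)) \<le> \<beta>"
      using AEA unfolding transfer \<alpha>\<beta>(1,2) A_def[symmetric]
      by (rule eventually_mono) (use \<alpha>\<beta>(3-5) in auto)
    ultimately show "\<exists>\<alpha> \<beta>. a \<le> \<alpha> \<and> \<alpha> \<le> \<beta> \<and> \<beta> \<le> b \<and> (2 ^ n) powr (\<beta> - \<alpha>) \<le> K \<and>
        (AE x in unit_leb. x \<in> dyadic_cell n k \<longrightarrow> \<alpha> \<le> max a (min b (p x)) \<and> max a (min b (p x)) \<le> \<beta>)"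
      using \<alpha>\<beta> by blast
  qed
qed

lemma tendsto_zero_ennrealI:
  fixes X :: "nat \<Rightarrow> ennreal"
  assumes "\<And>\<epsilon>. 0 < \<epsilon> \<Longrightarrow> \<forall>\<^sub>F n in sequentially. X n \<le> ennreal \<epsilon>"
  shows "X \<longlonglongrightarrow> 0"
proof (rule order_tendstoI)
  fix y :: ennreal assume "0 < y"
  then obtain z where z: "0 < z" "z < y" using dense by blast
  then have "z < top" using less_top order_less_le_trans by fastforce
  then obtain \<epsilon> where \<epsilon>: "z = ennreal \<epsilon>" "0 \<le> \<epsilon>" by (cases z) auto
  with z have "0 < \<epsilon>" by (cases "\<epsilon> = 0") auto
  from assms[OF this] show "\<forall>\<^sub>F n in sequentially. X n < y"
    by (rule eventually_mono) (use z \<epsilon> in auto)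
qed simp

theorem corollary5p2:
  fixes p f :: "real \<Rightarrow> real" and K :: real
  assumes "p \<in> borel_measurable unit_leb"
    and "\<And>x. x \<in> {0..<1} \<Longrightarrow> 0 < p x"
    and "1 < p_minus p {0..<1}"
    and "p_minus p {0..<1} \<le> p_plus p {0..<1}"
    and "p_plus p {0..<1} < \<infinity>"
    and "1 \<le> K"
    and "\<And>A. A \<in> dyadic_intervals \<Longrightarrow>
           measure lebesgue A powr real_of_ereal (p_minus p A - p_plus p A) \<le> K"
    and "f \<in> var_Lp p"
  shows "(\<lambda>n. luxemburg_norm p (\<lambda>x. walsh_partial_sum n f x - f x)) \<longlonglongrightarrow> 0"
proof -
  obtain a b where ab: "p_minus p {0..<1} = ereal a" "p_plus p {0..<1} = ereal b" and a: "1 < a"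
    using assms(3-5) by (cases "p_minus p {0..<1}"; cases "p_plus p {0..<1}") auto
  define P where "P x = max a (min b (p x))" for x
  have P: "dyadic_log_Hoelder a b P K" and AE: "AE x in unit_leb. a \<le> p x \<and> p x \<le> b"
    unfolding P_def[abs_def] using dyadic_log_Hoelder_of_p_minus_p_plus[OF assms(1) ab assms(7)] by auto
  note D = dyadic_log_HoelderD[OF P]
  have P1: "0 \<le> P x" for x using D(2)[of x] a by linarith
  have modular: "(\<integral>\<^sup>+x. ennreal ((\<bar>g x\<bar> / c) powr p x) \<partial>unit_leb) = (\<integral>\<^sup>+x. ennreal ((\<bar>g x\<bar> / c) powr P x) \<partial>unit_leb)" for g c
  proof (rule nn_integral_cong_AE)
    show "AE x in unit_leb. ennreal ((\<bar>g x\<bar> / c) powr p x) = ennreal ((\<bar>g x\<bar> / c) powr P x)"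
      using AE by (rule eventually_mono) (simp add: P_def)
  qed
  have fm: "f \<in> borel_measurable unit_leb" and fn: "luxemburg_norm p f < \<infinity>"
    using assms(8) unfolding var_Lp_def by auto
  obtain c where c: "0 < c" "(\<integral>\<^sup>+x. ennreal ((\<bar>f x\<bar> / c) powr P x) \<partial>unit_leb) \<le> 1"
  proof -
    have "{c::real. 0 < c \<and> (\<integral>\<^sup>+x. ennreal ((\<bar>f x\<bar> / c) powr p x) \<partial>unit_leb) \<le> 1} \<noteq> {}"
      using fn unfolding luxemburg_norm_def by (intro notI) simp
    then show ?thesis using that unfolding modular by blast
  qed
  have int: "integrable unit_leb (\<lambda>x. \<bar>f x\<bar> powr P x)"
  proof (rule Bochner_Integration.integrable_bound)
    have "(\<lambda>x. (\<bar>f x\<bar> / c) powr P x) \<in> borel_measurable unit_leb" using fm D(1) by measurable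
    then have "integrable unit_leb (\<lambda>x. (\<bar>f x\<bar> / c) powr P x)"
      by (rule integrableI_bounded) (use c(2) in \<open>auto simp: less_top[symmetric] top_unique\<close>)
    then show "integrable unit_leb (\<lambda>x. (1 + c) powr b * (\<bar>f x\<bar> / c) powr P x)"
      by (intro integrable_mult_right)
    show "(\<lambda>x. \<bar>f x\<bar> powr P x) \<in> borel_measurable unit_leb" using fm D(1) by measurable
    show "AE x in unit_leb. norm (\<bar>f x\<bar> powr P x) \<le> norm ((1 + c) powr b * (\<bar>f x\<bar> / c) powr P x)"
    proof (rule AE_I2)
      fix x
      have "\<bar>f x\<bar> powr P x = c powr P x * (\<bar>f x\<bar> / c) powr P x"
        using c(1) by (simp add: powr_mult[symmetric])
      also have "\<dots> \<le> (1 + c) powr P x * (\<bar>f x\<bar> / c) powr P x"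
        using c(1) P1[of x] by (intro mult_right_mono powr_mono2) auto
      also have "\<dots> \<le> (1 + c) powr b * (\<bar>f x\<bar> / c) powr P x"
        using c(1) D(3)[of x] by (intro mult_right_mono powr_mono) auto
      finally show "norm (\<bar>f x\<bar> powr P x) \<le> norm ((1 + c) powr b * (\<bar>f x\<bar> / c) powr P x)" by simp
    qed
  qed
  show ?thesis
  proof (rule tendsto_zero_ennrealI)
    fix \<epsilon> :: real assume \<epsilon>: "0 < \<epsilon>"
    from walsh_partial_sum_modular_tendsto[OF P a fm int \<epsilon>]
    show "\<forall>\<^sub>F n in sequentially. luxemburg_norm p (\<lambda>x. walsh_partial_sum n f x - f x) \<le> ennreal \<epsilon>"
    proof (rule eventually_mono, elim conjE)
      fix n
      assume i: "integrable unit_leb (\<lambda>x. (\<bar>walsh_partial_sum n f x - f x\<bar> / \<epsilon>) powr P x)"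
        and l: "(\<integral>x. (\<bar>walsh_partial_sum n f x - f x\<bar> / \<epsilon>) powr P x \<partial>unit_leb) \<le> 1"
      have "(\<integral>\<^sup>+x. ennreal ((\<bar>walsh_partial_sum n f x - f x\<bar> / \<epsilon>) powr p x) \<partial>unit_leb) \<le> 1"
        unfolding modular by (subst nn_integral_eq_integral[OF i]) (use l in auto)
      then show "luxemburg_norm p (\<lambda>x. walsh_partial_sum n f x - f x) \<le> ennreal \<epsilon>"
        unfolding luxemburg_norm_def using \<epsilon> by (intro INF_lower) simp
    qed
  qed
qed

end
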